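(* Let $n$ be a positive integer, let $r\ge 2$ and $t\ge 2$ be integers, and let $s_1,\dots,s_{t-1}$ be integers with $1\le s_1<s_2<\cdots<s_{t-1}<r$. Then the following three equalities hold: $$\#\mathcal{CP}_{\{r;s_1,\dots,s_{t-1}\}}(n)=\#\mathcal{RP}_{\{r;s_1,\dots,s_{t-1}\}}(n),$$ $$\#\mathcal{CP}'_{\{r;s_1,\dots,s_{t-1}\}}(n)=\#\mathcal{RP}'_{\{r;s_1,\dots,s_{t-1}\}}(n),$$ $$\#\mathcal{CP}''_{\{r;s_1,\dots,s_{t-1}\}}(n)=\#\mathcal{RP}''_{\{r;s_1,\dots,s_{t-1}\}}(n).$$
   Context: A partition of a positive integer $n$ is a sequence of integers $\lambda=(\lambda_1,\dots,\lambda_\ell)$ with $\lambda_1\ge\lambda_2\ge\cdots\ge\lambda_\ell>0$ and $\sum_i\lambda_i=n$; $\ell(\lambda)=\ell$ is its length, the $\lambda_i$ are its parts, and $m_k(\lambda)$ is the number of parts equal to $k$. For a set $\mathcal{X}$ of partitions, $\mathcal{X}(n)$ denotes the set of partitions of $n$ belonging to $\mathcal{X}$. The notation $(k_1^{a_1}k_2^{a_2}\cdots)$ denotes the partition with $a_i$ parts equal to $k_i$. For a positive integer $r$ and a part $\lambda_i$, put $Q_r(\lambda_i)=\lfloor \lambda_i/r\rfloor$, $R_r(\lambda_i)=\lambda_i-rQ_r(\lambda_i)$ and $QR_r(\lambda_i)=(Q_r(\lambda_i),R_r(\lambda_i))$. $\mathcal{CP}_r$ is the set of partitions having no part divisible by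 $r$. Fix $1\le s_1<\cdots<s_{t-1}<r$ and set $s_0=0$, $s_t=r$. $\mathcal{RP}_{\{r;s_1,\dots,s_{t-1}\}}$ is the set of partitions of the form $$\lambda=(k_1^{s_1}k_2^{s_2-s_1}\cdots k_t^{r-s_{t-1}}k_{t+1}^{s_1}k_{t+2}^{s_2-s_1}\cdots),\qquad k_1>k_2>\cdots>0 .$$ That is, if $k_1>k_2>\cdots>k_h>0$ are the distinct part sizes of $\lambda$ ($h$ is arbitrary, not necessarily a multiple of $t$), then for each $1\le i\le h$ one has $m_{k_i}(\lambda)=s_j-s_{j-1}$, where $j\in\{1,\dots,t\}$ is determined by $j\equiv i\pmod t$. $\mathcal{CP}_{\{r;s_1,\dots,s_{t-1}\}}$ is the set of $\lambda\in\mathcal{CP}_r$ such that for every index $i$ with $1\le i\le \ell(\lambda)$: (1) there is $j$ with $1\le j\le t-1$ and $R_r(\lambda_i)=s_j$; (2) if $Q_r(\lambda_i)\ge i$, then $R_r(\lambda_i)=s_{t-1}$ and for every $a$ with $1\le a<t-1$ there is an index $k\in\{1,\dots,\ell(\lambda)\}$ with $QR_r(\lambda_k)=(i-1,s_a)$; (3) if $Q_r(\lambda_i)=i-1$ and $R_r(\lambda_i)=s_j$, then for every $a$ with $1\le a<j$ there is an index $k\in\{1,\dots,\ell(\lambda)\}$ with $QR_r(\lambda_k)=(i-1,s_a)$. $\mathcal{RP}'_{\{r;s_1,\dots,s_{t-1}\}}$ is the set of $\lambda\in\mathcal{RP}_{\{r;s_1,\dots,s_{t-1}\}}$ with $\ell(\lambda)\equiv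 0\pmod r$. $\mathcal{CP}'_{\{r;s_1,\dots,s_{t-1}\}}$ is the set of $\lambda\in\mathcal{CP}_{\{r;s_1,\dots,s_{t-1}\}}$ such that $Q_r(\lambda_i)\ne i-1$ for every $1\le i\le\ell(\lambda)$. $\mathcal{RP}''_{\{r;s_1,\dots,s_{t-1}\}}$ is the set of $\lambda\in\mathcal{RP}_{\{r;s_1,\dots,s_{t-1}\}}$ with $\ell(\lambda)\equiv 0$ or $\ell(\lambda)\equiv s_{t-1}\pmod r$. $\mathcal{CP}''_{\{r;s_1,\dots,s_{t-1}\}}$ is the set of $\lambda\in\mathcal{CP}_{\{r;s_1,\dots,s_{t-1}\}}$ such that for every $1\le i\le\ell(\lambda)$, $Q_r(\lambda_i)\ge i-1$ implies $R_r(\lambda_i)=s_{t-1}$. *)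

theory Defs
  imports Main "HOL-Number_Theory.Cong"
begin

text \<open>
  A partition is the weakly decreasing list of its (positive) parts. Partitions are of positive
  integers, so the empty list is excluded. The length \<open>\<ell>(\<lambda>)\<close> is \<^term>\<open>length l\<close> and the multiplicity
  \<open>m\<^sub>k(\<lambda>)\<close> is \<^term>\<open>count_list l k\<close>.
\<close>

definition partitions :: "nat list set" where
  "partitions = {l. l \<noteq> [] \<and> sorted_wrt (\<ge>) l \<and> (\<forall>x\<in>set l. 0 < x)}"

text \<open>\<open>\<X>(n)\<close>, the members of \<open>\<X>\<close> that are partitions of \<open>n\<close>:\<close>

definition of_size :: "nat list set \<Rightarrow> nat \<Rightarrow> nat list set" where
  "of_size X n = {l \<in> X. l \<in> partitions \<and> sum_list l = n}"

text \<open>Indices of parts start at 1, as in the mathematical notation \<open>\<lambda>\<^sub>1 \<ge> \<lambda>\<^sub>2 \<ge> \<dots>\<close>:\<close>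

definition part :: "nat list \<Rightarrow> nat \<Rightarrow> nat" where
  "part l i = l ! (i - 1)"

definition Qr :: "nat \<Rightarrow> nat \<Rightarrow> nat" where
  "Qr r x = x div r"

definition Rr :: "nat \<Rightarrow> nat \<Rightarrow> nat" where
  "Rr r x = x - r * Qr r x"

definition QRr :: "nat \<Rightarrow> nat \<Rightarrow> nat \<times> nat" where
  "QRr r x = (Qr r x, Rr r x)"

text \<open>
  A tuple \<open>s\<^sub>1 < \<dots> < s\<^sub>t\<^sub>-\<^sub>1\<close> is given by a function \<open>s\<close> of which only the values at
  \<open>1, \<dots>, t - 1\<close> are used; \<open>ext\<close> adds the conventions \<open>s\<^sub>0 = 0\<close> and \<open>s\<^sub>t = r\<close>.
\<close>

definition ext :: "nat \<Rightarrow> nat \<Rightarrow> (nat \<Rightarrow> nat) \<Rightarrow> nat \<Rightarrow> nat" where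
  "ext r t s j = (if j = 0 then 0 else if j = t then r else s j)"

text \<open>
  In \<open>RP\<close>, \<open>ks\<close> is the list \<open>k\<^sub>1 > \<dots> > k\<^sub>h\<close> of distinct part sizes, and \<open>j\<close> is the unique element
  of \<open>{1..t}\<close> congruent to \<open>i\<close>.
\<close>

definition RP :: "nat \<Rightarrow> nat \<Rightarrow> (nat \<Rightarrow> nat) \<Rightarrow> nat list set" where
  "RP r t s = {l \<in> partitions.
     \<exists>ks. sorted_wrt (>) ks \<and> set ks = set l \<and>
       (\<forall>i\<in>{1..length ks}. \<forall>j\<in>{1..t}. [j = i] (mod t) \<longrightarrow>
          count_list l (ks ! (i - 1)) = ext r t s j - ext r t s (j - 1))}"

definition CP_nodiv :: "nat \<Rightarrow> nat list set" where
  "CP_nodiv r = {l \<in> partitions. \<forall>x\<in>set l. \<not> r dvd x}"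

definition CP :: "nat \<Rightarrow> nat \<Rightarrow> (nat \<Rightarrow> nat) \<Rightarrow> nat list set" where
  "CP r t s = {l \<in> CP_nodiv r. \<forall>i\<in>{1..length l}.
     (\<exists>j\<in>{1..t - 1}. Rr r (part l i) = s j) \<and>
     (Qr r (part l i) \<ge> i \<longrightarrow>
        Rr r (part l i) = s (t - 1) \<and>
        (\<forall>a\<in>{1..<t - 1}. \<exists>k\<in>{1..length l}. QRr r (part l k) = (i - 1, s a))) \<and>
     (\<forall>j\<in>{1..t - 1}. Qr r (part l i) = i - 1 \<and> Rr r (part l i) = s j \<longrightarrow>
        (\<forall>a\<in>{1..<j}. \<exists>k\<in>{1..length l}. QRr r (part l k) = (i - 1, s a)))}"

definition RP' :: "nat \<Rightarrow> nat \<Rightarrow> (nat \<Rightarrow> nat) \<Rightarrow> nat list set" where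
  "RP' r t s = {l \<in> RP r t s. [length l = 0] (mod r)}"

definition CP' :: "nat \<Rightarrow> nat \<Rightarrow> (nat \<Rightarrow> nat) \<Rightarrow> nat list set" where
  "CP' r t s = {l \<in> CP r t s. \<forall>i\<in>{1..length l}. Qr r (part l i) \<noteq> i - 1}"

definition RP'' :: "nat \<Rightarrow> nat \<Rightarrow> (nat \<Rightarrow> nat) \<Rightarrow> nat list set" where
  "RP'' r t s = {l \<in> RP r t s. [length l = 0] (mod r) \<or> [length l = s (t - 1)] (mod r)}"

definition CP'' :: "nat \<Rightarrow> nat \<Rightarrow> (nat \<Rightarrow> nat) \<Rightarrow> nat list set" where
  "CP'' r t s = {l \<in> CP r t s. \<forall>i\<in>{1..length l}.
     Qr r (part l i) \<ge> i - 1 \<longrightarrow> Rr r (part l i) = s (t - 1)}"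

text \<open>The cardinalities of the sets \<open>\<X>(n)\<close> are therefore genuine:\<close>

lemma finite_of_size: "finite (of_size X n)"
proof -
  have len: "length l \<le> sum_list l" if "\<forall>x\<in>set l. 0 < x" for l :: "nat list"
    using that by (induction l) (auto simp: Suc_le_eq intro: add_mono)
  have "of_size X n \<subseteq> {l. set l \<subseteq> {..n} \<and> length l \<le> n}"
    by (auto simp: of_size_def partitions_def len intro: member_le_sum_list)
  then show ?thesis
    by (rule finite_subset) (simp add: finite_lists_length_le)
qed

end

(*
  Put psum (t q + j) = r q + s_j for 0 \<le> j < t. Both sides are in bijection with the pairs (h, f)
  where f is positive exactly on {1..h} and n = sum of f i * psum i over i = 1, ..., h.

  For RP, h is the number of distinct part sizes and f i is the difference of the i-th and the
  (i+1)-st part size; psum i is the number of parts of at least the i-th size.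

  For CP, let d = h div t be the number of indices i with Q(part i) \<ge> i. The d first parts have
  residue s_(t-1), and their quotients carry the values f (t q), q = 1, ..., d; among the remaining
  parts psum i has multiplicity f i (for t not dividing i), lowered by 1 if i < t d and
  i = -1 modulo t. The sizes match because d (r d + s_(t-1)) is the sum of r q for q = 1, ..., d
  and of r q + s_(t-1) for q = 0, ..., d - 1. The primed versions restrict h mod t.
*)
theory Submission
  imports Defs "HOL-Library.Multiset"
begin

text \<open>A configuration is the conjugate of an RP partition: that conjugate has exactly the part
  sizes \<open>psum 1\<close>, ..., \<open>psum h\<close>, with multiplicities \<open>f i\<close>.
  Two mismatches separate such conjugates from CP. They contain multiples of r, namely
  \<open>psum (t * q)\<close>; and they contain r q + s_(t-1) for every q < d, whereas condition (2)
  asks only for the residues s_a with a < t - 1. The mismatches cancel. For each i = 1, ..., d one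
  copy of r (i - 1) + s_(t-1) is taken out as the base of the i-th large part, which is why a
  multiplicity is lowered and may become 0. The multiples of r, divided by r, form a partition with
  parts at most d, and r times the i-th part of its conjugate is added to the i-th base. This can be
  undone because d is visible in the result: all \<open>f (t * q)\<close> with 1 <= q <= d are
  positive, so the large parts have quotient at least d, while all other parts have quotient at most
  d. Hence d is the side of the Durfee square of the quotients.\<close>

section \<open>Lists with prescribed multiplicities\<close>

definition expand :: "('i \<Rightarrow> nat) \<Rightarrow> ('i \<Rightarrow> 'a) \<Rightarrow> 'i list \<Rightarrow> 'a list" where
  "expand m v xs = concat (map (\<lambda>i. replicate (m i) (v i)) xs)"

lemma expand_simps [simp]:
  "expand m v [] = []"
  "expand m v (x # xs) = replicate (m x) (v x) @ expand m v xs"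
  by (simp_all add: expand_def)

lemma set_expand: "set (expand m v xs) = v ` {i \<in> set xs. 0 < m i}"
  by (induction xs) auto

lemma length_expand: "length (expand m v xs) = (\<Sum>i\<leftarrow>xs. m i)"
  by (induction xs) auto

lemma sum_list_expand:
  fixes v :: "'i \<Rightarrow> nat"
  shows "sum_list (expand m v xs) = (\<Sum>i\<leftarrow>xs. m i * v i)"
  by (induction xs) (auto simp: sum_list_replicate)

lemma count_list_replicate: "count_list (replicate n x) y = (if x = y then n else 0)"
  by (induction n) auto

lemma count_list_expand:
  assumes "distinct xs" "inj_on v (set xs)" "i \<in> set xs"
  shows "count_list (expand m v xs) (v i) = m i"
  using assms
proof (induction xs)
  case (Cons x xs)
  show ?case
  proof (cases "i = x")
    case True
    then have "v i \<notin> v ` set xs"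
      using Cons.prems by auto
    then have "count_list (expand m v xs) (v i) = 0"
      by (intro count_notin) (auto simp: set_expand)
    then show ?thesis
      using True by (simp add: count_list_replicate)
  next
    case False
    then have "v x \<noteq> v i"
      using Cons.prems by (auto simp: inj_on_def)
    then show ?thesis
      using Cons False by (auto simp: count_list_replicate)
  qed
qed simp

lemma sorted_expand:
  fixes v :: "'i \<Rightarrow> nat"
  assumes "sorted_wrt (\<lambda>i j. v j < v i) xs"
  shows "sorted_wrt (\<ge>) (expand m v xs)"
  using assms
proof (induction xs)
  case (Cons x xs)
  have "sorted_wrt (\<ge>) (replicate n (v x))" for n
    by (induction n) auto
  then show ?case
    using Cons by (auto simp: sorted_wrt_append set_expand intro: less_imp_le)
qed simp

lemma sorted_ge_unique:
  fixes l l' :: "nat list"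
  assumes "sorted_wrt (\<ge>) l" "sorted_wrt (\<ge>) l'" "\<And>x. count_list l x = count_list l' x"
  shows "l = l'"
proof -
  have "mset l = mset l'"
    using assms(3) by (intro multiset_eqI) (simp add: count_mset)
  then have "mset (rev l) = mset (rev l')"
    by simp
  moreover have "sorted (rev l)" "sorted (rev l')"
    using assms by (simp_all add: sorted_wrt_rev)
  ultimately have "rev l = rev l'"
    by (metis properties_for_sort)
  then show ?thesis
    by simp
qed

lemma sorted_greater_unique:
  fixes xs ys :: "nat list"
  assumes "sorted_wrt (>) xs" "sorted_wrt (>) ys" "set xs = set ys"
  shows "xs = ys"
proof -
  have "sorted_wrt (<) (rev xs)" "sorted_wrt (<) (rev ys)"
    using assms by (simp_all add: sorted_wrt_rev)
  then have "rev xs = rev ys"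
    using assms(3) by (intro strict_sorted_equal) auto
  then show ?thesis
    by simp
qed

lemma inj_on_if_sorted_wrt:
  fixes v :: "'i \<Rightarrow> nat"
  assumes "sorted_wrt (\<lambda>i j. v j < v i) xs"
  shows "distinct xs" "inj_on v (set xs)"
proof -
  have "distinct xs \<and> inj_on v (set xs)"
    using assms
  proof (induction xs)
    case (Cons x xs)
    then have "v x \<notin> v ` set xs"
      by auto
    then show ?case
      using Cons by auto
  qed simp
  then show "distinct xs" "inj_on v (set xs)"
    by simp_all
qed

text \<open>A decreasing list is determined by its multiplicities; both surjectivity proofs end with
  this. The inclusion allows indices of multiplicity 0, which occur on the CP side.\<close>

lemma expand_eq:
  fixes l :: "nat list"
  assumes "sorted_wrt (\<ge>) l" "sorted_wrt (\<lambda>i j. v j < v i) xs"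
    and "set l \<subseteq> v ` set xs" "\<And>i. i \<in> set xs \<Longrightarrow> m i = count_list l (v i)"
  shows "expand m v xs = l"
proof (rule sorted_ge_unique)
  show "sorted_wrt (\<ge>) (expand m v xs)"
    using assms by (simp add: sorted_expand)
  show "count_list (expand m v xs) x = count_list l x" for x
  proof (cases "x \<in> v ` set xs")
    case True
    then show ?thesis
      using assms inj_on_if_sorted_wrt[OF assms(2)] by (auto simp: count_list_expand)
  next
    case False
    then have "x \<notin> set l" "x \<notin> set (expand m v xs)"
      using assms(3) by (auto simp: set_expand)
    then show ?thesis
      by (simp add: count_notin)
  qed
qed (fact assms(1))

lemma sorted_wrt_uptI:
  assumes "\<And>i j. a \<le> i \<Longrightarrow> i < j \<Longrightarrow> j < b \<Longrightarrow> R i j"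
  shows "sorted_wrt R [a..<b]"
  using sorted_wrt_upt[of a b] by (rule sorted_wrt_mono_rel[rotated]) (use assms in auto)

section \<open>Telescoping and summation by parts\<close>

text \<open>Truncated differences telescope only where the sequence decreases; the computation
  therefore passes through \<open>int\<close>.\<close>

lemma sum_telescope_nat:
  fixes K :: "nat \<Rightarrow> nat"
  assumes dec: "\<And>q. i \<le> q \<Longrightarrow> q \<le> d \<Longrightarrow> K (Suc q) \<le> K q" and "i \<le> Suc d"
  shows "(\<Sum>q=i..d. K q - K (Suc q)) = K i - K (Suc d)"
proof -
  have "int (\<Sum>q=i..d. K q - K (Suc q)) = (\<Sum>q=i..d. int (K q) - int (K (Suc q)))"
    unfolding of_nat_sum by (intro sum.cong refl of_nat_diff dec) simp_all
  also have "\<dots> = int (K i) - int (K (Suc d))"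
    using sum_Suc_diff[of i d "\<lambda>q. - int (K q)"] \<open>i \<le> Suc d\<close> by simp
  finally show ?thesis
    by linarith
qed

text \<open>Each value is the difference of two consecutive tail sums, the tail beyond
  \<open>d\<close> being empty. Both injectivity proofs recover \<open>f\<close> in this
  way.\<close>

lemma sum_tail_eqD:
  fixes f g :: "nat \<Rightarrow> nat"
  assumes "\<And>i. a \<le> i \<Longrightarrow> i \<le> d \<Longrightarrow> (\<Sum>q=i..d. f q) = (\<Sum>q=i..d. g q)"
    and "a \<le> i" "i \<le> d"
  shows "f i = g i"
proof -
  have "(\<Sum>q=Suc i..d. f q) = (\<Sum>q=Suc i..d. g q)"
    using assms(1)[of "Suc i"] assms(2) by (cases "Suc i \<le> d") auto
  then show ?thesis
    using assms(1)[of i] assms(2,3) by (simp add: sum.atLeast_Suc_atMost)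
qed

text \<open>Summation by parts: \<open>F q\<close> is counted for every i <= q, and these weights
  telescope to \<open>w q\<close>. With w = \<open>psum\<close> this gives the size of an RP
  partition, with the identity the total of the large parts of a CP partition.\<close>

lemma sum_weighted_tails:
  fixes w F :: "nat \<Rightarrow> nat"
  assumes "\<And>i. w i \<le> w (Suc i)" "w 0 = 0"
  shows "(\<Sum>i=1..d. (w i - w (i - 1)) * (\<Sum>q=i..d. F q)) = (\<Sum>q=1..d. w q * F q)"
proof (induction d)
  case (Suc d)
  have tel: "(\<Sum>i=1..d. w i - w (i - 1)) = w d" for d
    by (induction d) (use assms in auto)
  have "(\<Sum>i=1..Suc d. (w i - w (i - 1)) * (\<Sum>q=i..Suc d. F q))
      = (\<Sum>i=1..Suc d. (w i - w (i - 1)) * (\<Sum>q=i..d. F q) + (w i - w (i - 1)) * F (Suc d))"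
    by (intro sum.cong) (auto simp: algebra_simps)
  also have "\<dots> = (\<Sum>q=1..d. w q * F q) + (\<Sum>i=1..Suc d. w i - w (i - 1)) * F (Suc d)"
    using Suc unfolding sum.distrib sum_distrib_right by simp
  also have "\<dots> = (\<Sum>q=1..Suc d. w q * F q)"
    unfolding tel by simp
  finally show ?case .
qed simp

lemma part_in_set: "i \<in> {1..length l} \<Longrightarrow> part l i \<in> set l"
  by (auto simp: part_def)

lemma in_set_part: "x \<in> set l \<longleftrightarrow> (\<exists>i\<in>{1..length l}. part l i = x)"
proof
  assume "x \<in> set l"
  then obtain i where "i < length l" "l ! i = x"
    by (auto simp: in_set_conv_nth)
  then show "\<exists>i\<in>{1..length l}. part l i = x"
    by (intro bexI[of _ "Suc i"]) (auto simp: part_def)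
qed (auto simp: part_in_set)

lemma part_antimono:
  assumes "sorted_wrt (\<ge>) l" "1 \<le> i" "i \<le> j" "j \<le> length l"
  shows "part l j \<le> part l i"
  using assms sorted_wrt_nth_less[OF assms(1), of "i - 1" "j - 1"]
  by (cases "i = j") (auto simp: part_def)

section \<open>Cumulative multiplicities and configurations\<close>

locale residue_system =
  fixes r t :: nat and s :: "nat \<Rightarrow> nat"
  assumes t_ge: "t \<ge> 2"
    and s1: "1 \<le> s 1" and s_Suc: "\<forall>i\<in>{1..<t - 1}. s i < s (i + 1)" and s_last: "s (t - 1) < r"
begin

lemma s_mono: "1 \<le> i \<Longrightarrow> i < j \<Longrightarrow> j \<le> t - 1 \<Longrightarrow> s i < s j"
proof (induction j)
  case (Suc j)
  then show ?case
    using s_Suc by (cases "i = j") (auto intro: less_trans)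
qed simp

lemma s_pos: "1 \<le> i \<Longrightarrow> i \<le> t - 1 \<Longrightarrow> 0 < s i"
  using s_mono[of 1 i] s1 by (cases "i = 1") auto

lemma s_less: "1 \<le> i \<Longrightarrow> i \<le> t - 1 \<Longrightarrow> s i < r"
  using s_mono[of i "t - 1"] s_last by (cases "i = t - 1") auto

lemma r_pos: "0 < r"
  using s_last by simp

text \<open>The multiples of \<open>t\<close> form a case of their own because \<open>s 0\<close> is
  an arbitrary value, not the convention s_0 = 0.\<close>

definition psum :: "nat \<Rightarrow> nat" where
  "psum i = r * (i div t) + (if t dvd i then 0 else s (i mod t))"

lemma psum_eq: "j < t \<Longrightarrow> psum (t * q + j) = r * q + (if j = 0 then 0 else s j)"
  by (auto simp: psum_def dvd_eq_mod_eq_0)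

lemma mod_range: "\<not> t dvd i \<Longrightarrow> 1 \<le> i mod t \<and> i mod t \<le> t - 1"
  using t_ge mod_less_divisor[of t i] by (auto simp: dvd_eq_mod_eq_0 simp del: mod_less_divisor)

lemma psum_div: "psum i div r = i div t"
  using s_less mod_range r_pos by (auto simp: psum_def)

lemma psum_mod: "psum i mod r = (if t dvd i then 0 else s (i mod t))"
  using s_less mod_range by (auto simp: psum_def)

text \<open>The increments of \<open>psum\<close> are the multiplicities prescribed by RP. Either
  the step stays inside a block of \<open>t\<close> indices, or it carries from r q + s_(t-1) to r
  (q + 1), which yields the last multiplicity r - s_(t-1).\<close>

lemma psum_Suc: "psum (Suc i) - psum i = ext r t s (Suc (i mod t)) - ext r t s (i mod t)"
  and psum_less_Suc: "psum i < psum (Suc i)"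
proof -
  obtain q j where i: "i = t * q + j" and j: "j < t"
    using t_ge by (metis mult_div_mod_eq mod_less_divisor not_gr_zero not_numeral_le_zero)
  have im: "i mod t = j"
    using i j by simp
  consider "Suc j = t" | "Suc j < t"
    using j by linarith
  then have "psum (Suc i) - psum i = ext r t s (Suc (i mod t)) - ext r t s (i mod t) \<and> psum i < psum (Suc i)"
  proof cases
    case 1
    then have "Suc i = t * Suc q + 0" "j \<noteq> 0" "j = t - 1"
      using i t_ge by auto
    moreover have "psum i = r * q + s j"
      using psum_eq[OF j, of q] i \<open>j \<noteq> 0\<close> by simp
    moreover have "psum (Suc i) = r * q + r"
      using psum_eq[of 0 "Suc q"] t_ge \<open>Suc i = t * Suc q + 0\<close> by simp
    moreover have "s j < r"
      using s_last \<open>j = t - 1\<close> by simp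
    ultimately show ?thesis
      using im 1 j by (simp add: ext_def)
  next
    case 2
    then have "Suc i = t * q + Suc j"
      using i by simp
    then show ?thesis
      using psum_eq[OF j, of q] psum_eq[OF 2, of q] i im s_mono[of j "Suc j"] s1 2
      by (auto simp: ext_def)
  qed
  then show "psum (Suc i) - psum i = ext r t s (Suc (i mod t)) - ext r t s (i mod t)" "psum i < psum (Suc i)"
    by auto
qed

lemma psum_strict_mono: "strict_mono psum"
  by (simp add: strict_mono_Suc_iff psum_less_Suc)

lemma psum_0 [simp]: "psum 0 = 0"
  by (simp add: psum_def)

lemma psum_pos: "0 < i \<Longrightarrow> 0 < psum i"
  using psum_strict_mono by (metis psum_0 strict_mono_less)

text \<open>Since \<open>f\<close> is 0 outside {1..h}, it has no junk values: injectivity can be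
  stated as equality of functions, and \<open>h\<close> can be read off \<open>f\<close>.\<close>

definition conf :: "nat \<Rightarrow> (nat \<times> (nat \<Rightarrow> nat)) set" where
  "conf n = {(h, f). (\<forall>i. 0 < f i \<longleftrightarrow> i \<in> {1..h}) \<and> (\<Sum>i=1..h. psum i * f i) = n}"

lemma conf_pos: "(h, f) \<in> conf n \<Longrightarrow> 0 < f i \<longleftrightarrow> 1 \<le> i \<and> i \<le> h"
  by (auto simp: conf_def)

lemma conf_h: "(h, f) \<in> conf n \<Longrightarrow> 0 < n \<Longrightarrow> 0 < h"
  by (cases h) (auto simp: conf_def)

lemma conf_h_unique:
  assumes "(h, f) \<in> conf n" "(h', f) \<in> conf n'"
  shows "h = h'"
proof -
  have "1 \<le> i \<and> i \<le> h \<longleftrightarrow> 1 \<le> i \<and> i \<le> h'" for i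
    using conf_pos[OF assms(1)] conf_pos[OF assms(2)] by blast
  from this[of h] this[of h'] show ?thesis
    by (cases "h = 0"; cases "h' = 0") auto
qed

section \<open>The bijection between configurations and RP\<close>

definition toRP :: "nat \<times> (nat \<Rightarrow> nat) \<Rightarrow> nat list" where
  "toRP = (\<lambda>(h, f). expand (\<lambda>i. psum i - psum (i - 1)) (\<lambda>i. \<Sum>q=i..h. f q) [1..<Suc h])"

lemma mult_pos: "1 \<le> i \<Longrightarrow> psum (i - 1) < psum i"
  using psum_less_Suc[of "i - 1"] by simp

text \<open>Lowering both indices by one turns the range 1, ..., t of \<open>j\<close> into the
  remainders 0, ..., t - 1, so that \<open>j - 1\<close> is the remainder of \<open>i - 1\<close>
  and \<open>psum_Suc\<close> applies.\<close>

lemma mult_cong: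
  assumes "1 \<le> i" "j \<in> {1..t}" "[j = i] (mod t)"
  shows "psum i - psum (i - 1) = ext r t s j - ext r t s (j - 1)"
proof -
  have "[Suc (j - 1) = Suc (i - 1)] (mod t)"
    using assms by simp
  then have "[j - 1 = i - 1] (mod t)"
    by (metis add.commute cong_add_rcancel_nat plus_1_eq_Suc)
  then have "(i - 1) mod t = j - 1"
    using assms(2) by (auto simp: cong_def)
  then show ?thesis
    using psum_Suc[of "i - 1"] assms(1,2) by simp
qed

lemma ex_cong:
  obtains j where "j \<in> {1..t}" "[j = i] (mod t)"
proof (cases "t dvd i")
  case True
  then show ?thesis
    using that[of t] t_ge by (auto simp: cong_def)
next
  case False
  then show ?thesis
    using that[of "i mod t"] mod_range[OF False] by (auto simp: cong_def)
qed

lemma sorted_tails: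
  assumes "(h, f) \<in> conf n"
  shows "sorted_wrt (\<lambda>i j. (\<Sum>q=j..h. f q) < (\<Sum>q=i..h. f q)) [1..<Suc h]"
proof (rule sorted_wrt_uptI)
  fix i j assume ij: "1 \<le> i" "i < j" "j < Suc h"
  show "(\<Sum>q=j..h. f q) < (\<Sum>q=i..h. f q)"
    using ij conf_pos[OF assms, of i] by (intro sum_strict_mono2[of _ _ i]) auto
qed

text \<open>The multiplicities telescope. This ties the length conditions modulo r to
  \<open>h mod t\<close>.\<close>

lemma length_toRP: "length (toRP (h, f)) = psum h"
proof (induction h)
  case (Suc h)
  then show ?case
    using psum_less_Suc[of h] by (simp add: toRP_def length_expand)
qed (simp add: toRP_def)

lemma toRP_in:
  assumes "(h, f) \<in> conf n" "0 < n"
  shows "toRP (h, f) \<in> of_size (RP r t s) n"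
proof -
  let ?k = "\<lambda>i. \<Sum>q=i..h. f q"
  let ?ks = "map ?k [1..<Suc h]"
  have pos: "0 < ?k i" if "1 \<le> i" "i \<le> h" for i
    using that conf_pos[OF assms(1), of i] by (auto intro: sum_pos2[of _ i])
  have set: "set (toRP (h, f)) = ?k ` {1..h}"
    using mult_pos by (force simp: toRP_def set_expand)
  have "length (toRP (h, f)) \<noteq> 0"
    using conf_h[OF assms] psum_pos[of h] by (simp add: length_toRP)
  then have "toRP (h, f) \<in> partitions"
    using set pos sorted_expand[OF sorted_tails[OF assms(1)]]
    by (auto simp: partitions_def toRP_def)
  moreover have "sorted_wrt (>) ?ks"
    using sorted_tails[OF assms(1)] by (simp add: sorted_wrt_map del: upt_Suc)
  moreover have "set ?ks = set (toRP (h, f))"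
    using set by (auto simp del: upt_Suc)
  moreover have "count_list (toRP (h, f)) (?ks ! (i - 1)) = ext r t s j - ext r t s (j - 1)"
    if "i \<in> {1..length ?ks}" "j \<in> {1..t}" "[j = i] (mod t)" for i j
  proof -
    have i: "1 \<le> i" "i \<le> h"
      using that by (auto simp del: upt_Suc)
    then have "?ks ! (i - 1) = ?k i"
      by (simp del: upt_Suc)
    moreover have "count_list (toRP (h, f)) (?k i) = psum i - psum (i - 1)"
      unfolding toRP_def prod.case
      using i by (intro count_list_expand inj_on_if_sorted_wrt[OF sorted_tails[OF assms(1)]]) auto
    ultimately show ?thesis
      using mult_cong[OF i(1) that(2,3)] by simp
  qed
  ultimately have "toRP (h, f) \<in> RP r t s"
    unfolding RP_def by blast
  \<comment> \<open>The multiplicities are the increments of \<open>psum\<close>, so summation by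
    parts produces the weighted sum in \<open>conf\<close>.\<close>
  moreover have "sum_list (toRP (h, f)) = n"
    using assms(1) sum_weighted_tails[where w = psum and F = f and d = h] psum_less_Suc
    by (simp add: toRP_def sum_list_expand conf_def interv_sum_list_conv_sum_set_nat
        atLeastLessThanSuc_atLeastAtMost less_imp_le del: upt_Suc)
  ultimately show ?thesis
    using \<open>toRP (h, f) \<in> partitions\<close> by (simp add: of_size_def)
qed

text \<open>The set of parts alone suffices: listed decreasingly, it is the list of tail sums of
  \<open>f\<close>, whose length is \<open>h\<close> and whose differences are the values of
  \<open>f\<close>.\<close>

lemma toRP_inj: "inj_on toRP (conf n)"
proof (rule inj_onI, clarify)
  fix h f h' f'
  assume c: "(h, f) \<in> conf n" "(h', f') \<in> conf n" and eq: "toRP (h, f) = toRP (h', f')"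
  let ?ks = "\<lambda>h f. map (\<lambda>i. \<Sum>q=i..h. f q) [1..<Suc h]"
  have set: "set (toRP (h, f)) = set (?ks h f)" for h :: nat and f :: "nat \<Rightarrow> nat"
    using mult_pos by (force simp: toRP_def set_expand simp del: upt_Suc)
  have "sorted_wrt (>) (?ks h f)" "sorted_wrt (>) (?ks h' f')"
    using c[THEN sorted_tails] by (simp_all add: sorted_wrt_map del: upt_Suc)
  then have ks: "?ks h f = ?ks h' f'"
    using eq set by (intro sorted_greater_unique) metis+
  then have h: "h = h'"
    by (metis diff_Suc_1 length_map length_upt)
  have "(\<Sum>q=i..h. f q) = (\<Sum>q=i..h. f' q)" if "1 \<le> i" "i \<le> h" for i
    using that ks h by (auto simp: map_eq_conv simp del: upt_Suc)
  then have "f i = f' i" if "1 \<le> i" "i \<le> h" for i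
    using sum_tail_eqD[of 1 h f f' i] that by auto
  moreover have "f i = f' i" if "\<not> (1 \<le> i \<and> i \<le> h)" for i
    using that conf_pos[OF c(1), of i] conf_pos[OF c(2), of i] h by auto
  ultimately show "h = h' \<and> f = f'"
    using h by blast
qed

lemma toRP_surj:
  assumes "l \<in> of_size (RP r t s) n"
  shows "l \<in> toRP ` conf n"
proof -
  have l: "l \<in> partitions" and sum: "sum_list l = n" and RP: "l \<in> RP r t s"
    using assms by (simp_all add: of_size_def)
  from RP have "\<exists>ks. sorted_wrt (>) ks \<and> set ks = set l \<and>
       (\<forall>i\<in>{1..length ks}. \<forall>j\<in>{1..t}. [j = i] (mod t) \<longrightarrow>
          count_list l (ks ! (i - 1)) = ext r t s j - ext r t s (j - 1))"
    unfolding RP_def mem_Collect_eq by (rule conjunct2)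
  then obtain ks where "sorted_wrt (>) ks \<and> set ks = set l \<and>
       (\<forall>i\<in>{1..length ks}. \<forall>j\<in>{1..t}. [j = i] (mod t) \<longrightarrow>
          count_list l (ks ! (i - 1)) = ext r t s j - ext r t s (j - 1))" ..
  note ks = this[THEN conjunct1] this[THEN conjunct2, THEN conjunct1]
    and cnt = this[THEN conjunct2, THEN conjunct2]
  define h where "h = length ks"
  \<comment> \<open>The value 0 beyond the last size makes \<open>f h\<close> equal to the smallest
    part.\<close>
  define K where "K i = (if i \<le> h then ks ! (i - 1) else 0)" for i
  define f where "f i = (if i \<in> {1..h} then K i - K (Suc i) else 0)" for i
  have ks_in: "ks ! (i - 1) \<in> set l" if "1 \<le> i" "i \<le> h" for i
    using that nth_mem[of "i - 1" ks] unfolding ks h_def by linarith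
  have l_pos: "\<forall>x\<in>set l. 0 < x" and l_sorted: "sorted_wrt (\<ge>) l"
    using l by (simp_all add: partitions_def)
  have Kpos: "0 < K i" if "1 \<le> i" "i \<le> h" for i
    using ks_in[OF that] l_pos that by (simp add: K_def)
  have Kdec: "K (Suc i) < K i" if "1 \<le> i" "i \<le> h" for i
    using that Kpos[OF that] sorted_wrt_nth_less[OF ks(1), of "i - 1" i] by (auto simp: K_def h_def)
  have tails: "(\<Sum>q=i..h. f q) = K i" if "1 \<le> i" "i \<le> h" for i
  proof -
    have "(\<Sum>q=i..h. f q) = (\<Sum>q=i..h. K q - K (Suc q))"
      using that by (intro sum.cong) (auto simp: f_def)
    also have "\<dots> = K i - K (Suc h)"
      using that by (intro sum_telescope_nat) (auto intro!: less_imp_le[OF Kdec])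
    also have "\<dots> = K i"
      by (simp add: K_def)
    finally show ?thesis .
  qed
  have fpos: "0 < f i \<longleftrightarrow> i \<in> {1..h}" for i
    using Kdec[of i] by (simp add: f_def)
  \<comment> \<open>The pair is first a configuration of its own weighted sum; that this sum is
    \<open>n\<close> follows once \<open>toRP (h, f)\<close> is known to be
    \<open>l\<close>.\<close>
  then have c: "(h, f) \<in> conf (\<Sum>i=1..h. psum i * f i)"
    by (simp add: conf_def)
  have "toRP (h, f) = l"
    unfolding toRP_def prod.case
  proof (rule expand_eq[OF _ sorted_tails[OF c]])
    show "sorted_wrt (\<ge>) l"
      by (fact l_sorted)
    show "set l \<subseteq> (\<lambda>i. \<Sum>q=i..h. f q) ` set [1..<Suc h]"
    proof
      fix x assume "x \<in> set l"
      then obtain i where "i < h" "ks ! i = x"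
        using ks(2) by (metis h_def in_set_conv_nth)
      then show "x \<in> (\<lambda>i. \<Sum>q=i..h. f q) ` set [1..<Suc h]"
        using tails[of "Suc i"] by (intro image_eqI[of _ _ "Suc i"]) (auto simp: K_def)
    qed
    fix i assume "i \<in> set [1..<Suc h]"
    then have i: "1 \<le> i" "i \<le> h"
      by auto
    obtain j where j: "j \<in> {1..t}" "[j = i] (mod t)"
      by (rule ex_cong)
    have "count_list l (ks ! (i - 1)) = ext r t s j - ext r t s (j - 1)"
      using cnt i j by (simp add: h_def)
    with mult_cong[OF i(1) j] show "psum i - psum (i - 1) = count_list l (\<Sum>q=i..h. f q)"
      using i tails[OF i] by (simp add: K_def)
  qed
  moreover have "sum_list (toRP (h, f)) = (\<Sum>i=1..h. psum i * f i)"
    using sum_weighted_tails[where w = psum and F = f and d = h] psum_less_Suc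
    by (simp add: toRP_def sum_list_expand interv_sum_list_conv_sum_set_nat
        atLeastLessThanSuc_atLeastAtMost less_imp_le del: upt_Suc)
  ultimately have "(h, f) \<in> conf n"
    using c sum by simp
  then show ?thesis
    using \<open>toRP (h, f) = l\<close> by (metis image_eqI)
qed

lemma toRP_bij: "0 < n \<Longrightarrow> bij_betw toRP (conf n) (of_size (RP r t s) n)"
  using toRP_inj toRP_in toRP_surj by (force simp: bij_betw_def)

section \<open>The Durfee square of the quotients and the conditions of CP\<close>

lemma set_conv_part: "set l = part l ` {1..length l}"
  using in_set_part by (auto simp: image_iff Bex_def)

lemma psum_mult: "psum (t * q) = r * q"
  using psum_eq[of 0 q] t_ge by simp

lemma psum_add: "1 \<le> a \<Longrightarrow> a \<le> t - 1 \<Longrightarrow> psum (t * q + a) = r * q + s a"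
  using psum_eq[of a q] t_ge by simp

lemma s_less_iff: "a \<in> {1..t - 1} \<Longrightarrow> b \<in> {1..t - 1} \<Longrightarrow> s a < s b \<longleftrightarrow> a < b"
  by (metis atLeastAtMost_iff linorder_neqE_nat order_less_asym s_mono)

lemma s_eq_iff: "a \<in> {1..t - 1} \<Longrightarrow> b \<in> {1..t - 1} \<Longrightarrow> s a = s b \<longleftrightarrow> a = b"
  by (metis less_irrefl linorder_neqE_nat s_less_iff)

lemma Rr_eq: "Rr r x = x mod r"
  by (simp add: Rr_def Qr_def minus_mult_div_eq_mod)

text \<open>Quotient and residue determine a part, so the existence claims in conditions (2) and (3)
  become membership claims.\<close>

lemma ex_QRr_iff:
  assumes "a \<in> {1..t - 1}"
  shows "(\<exists>k\<in>{1..length l}. QRr r (part l k) = (q, s a)) \<longleftrightarrow> r * q + s a \<in> set l"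
proof -
  have sa: "s a < r"
    using assms s_less by simp
  have "QRr r x = (q, s a) \<longleftrightarrow> x = r * q + s a" for x
  proof
    assume "QRr r x = (q, s a)"
    then have "x div r = q" "x mod r = s a"
      by (simp_all add: QRr_def Rr_eq Qr_def)
    then show "x = r * q + s a"
      using mult_div_mod_eq[of r x] by simp
  qed (use sa in \<open>simp add: QRr_def Rr_eq Qr_def\<close>)
  then show ?thesis
    by (simp add: in_set_part)
qed

text \<open>\<open>d\<close> is the side of the Durfee square of the sequence of quotients by
  \<open>r\<close>.\<close>

definition durfee :: "nat list \<Rightarrow> nat \<Rightarrow> bool" where
  "durfee l d \<longleftrightarrow> d \<le> length l \<and> (\<forall>i\<in>{1..d}. i \<le> part l i div r)
     \<and> (\<forall>i\<in>{d<..length l}. part l i div r \<le> d)"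

lemma durfee_not_less: "durfee l d \<Longrightarrow> durfee l d' \<Longrightarrow> \<not> d < d'"
proof
  assume "durfee l d" "durfee l d'" "d < d'"
  then have "Suc d \<le> part l (Suc d) div r" "part l (Suc d) div r \<le> d"
    by (simp_all add: durfee_def)
  then show False
    by simp
qed

lemma durfee_unique: "durfee l d \<Longrightarrow> durfee l d' \<Longrightarrow> d = d'"
  using durfee_not_less[of l d d'] durfee_not_less[of l d' d] by linarith

lemma durfee_ex:
  assumes "sorted_wrt (\<ge>) l"
  obtains d where "durfee l d"
proof -
  \<comment> \<open>Read as an implication, \<open>?P\<close> holds at \<open>length l\<close>; so a
    least \<open>d\<close> exists and does not exceed the length.\<close>
  let ?P = "\<lambda>d. d < length l \<longrightarrow> part l (Suc d) div r \<le> d"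
  define d where "d = (LEAST d. ?P d)"
  have P: "?P (length l)"
    by simp
  have d: "?P d"
    unfolding d_def by (rule LeastI[of ?P, OF P])
  have d_le: "d \<le> length l"
    unfolding d_def by (rule Least_le[of ?P, OF P])
  have up: "i \<le> part l i div r" if "i \<in> {1..d}" for i
  proof -
    have "i - 1 < d"
      using that by auto
    then have "\<not> ?P (i - 1)"
      unfolding d_def by (rule not_less_Least)
    then show ?thesis
      using that by auto
  qed
  have low: "part l i div r \<le> d" if "i \<in> {d<..length l}" for i
  proof -
    have "part l i \<le> part l (Suc d)"
      using that by (intro part_antimono[OF assms]) auto
    then have "part l i div r \<le> part l (Suc d) div r"
      by (rule div_le_mono)
    then show ?thesis
      using d that by auto
  qed
  show ?thesis
    by (rule that[of d]) (simp add: durfee_def d_le up low)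
qed

text \<open>For i <= d the quotient is at least i, so condition (2) applies and speaks of the
  quotients i - 1 < d, while (3) is vacuous. For i > d the quotient is at most d, so (2) is vacuous
  and (3) can apply only to i = d + 1 with quotient exactly d.\<close>

lemma CP_iff:
  assumes "l \<in> partitions" "durfee l d"
  shows "l \<in> CP r t s \<longleftrightarrow>
      (\<forall>x\<in>set l. \<exists>j\<in>{1..t - 1}. x mod r = s j)
    \<and> (\<forall>i\<in>{1..d}. part l i mod r = s (t - 1))
    \<and> (\<forall>q<d. \<forall>a\<in>{1..<t - 1}. r * q + s a \<in> set l)
    \<and> (d < length l \<and> part l (Suc d) div r = d \<longrightarrow>
        (\<forall>a\<in>{1..t - 1}. s a < part l (Suc d) mod r \<longrightarrow> r * d + s a \<in> set l))"
  (is "_ \<longleftrightarrow> ?A \<and> ?B \<and> ?C \<and> ?D")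
proof -
  have d: "d \<le> length l" "\<And>i. 1 \<le> i \<Longrightarrow> i \<le> d \<Longrightarrow> i \<le> part l i div r"
    "\<And>i. d < i \<Longrightarrow> i \<le> length l \<Longrightarrow> part l i div r \<le> d"
    using assms(2) by (auto simp: durfee_def)
  have A: "?A \<longleftrightarrow> (\<forall>i\<in>{1..length l}. \<exists>j\<in>{1..t - 1}. part l i mod r = s j)"
    by (simp only: set_conv_part ball_simps)
  have nodiv: "l \<in> CP_nodiv r" if ?A
  proof -
    have "\<not> r dvd x" if "x \<in> set l" for x
    proof -
      obtain j where "j \<in> {1..t - 1}" "x mod r = s j"
        using \<open>?A\<close> \<open>x \<in> set l\<close> by blast
      then show ?thesis
        using s_pos[of j] by (simp add: dvd_eq_mod_eq_0)
    qed
    then show ?thesis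
      using assms(1) by (simp add: CP_nodiv_def)
  qed
  let ?cond2 = "\<lambda>i. i \<le> part l i div r \<longrightarrow> part l i mod r = s (t - 1)
      \<and> (\<forall>a\<in>{1..<t - 1}. r * (i - 1) + s a \<in> set l)"
  let ?cond3 = "\<lambda>i. \<forall>j\<in>{1..t - 1}. part l i div r = i - 1 \<and> part l i mod r = s j
      \<longrightarrow> (\<forall>a\<in>{1..<j}. r * (i - 1) + s a \<in> set l)"
  have CP: "l \<in> CP r t s \<longleftrightarrow> ?A \<and> (\<forall>i\<in>{1..length l}. ?cond2 i \<and> ?cond3 i)"
  proof -
    have 2: "(\<forall>a\<in>{1..<t - 1}. \<exists>k\<in>{1..length l}. QRr r (part l k) = (q, s a))
        \<longleftrightarrow> (\<forall>a\<in>{1..<t - 1}. r * q + s a \<in> set l)" for q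
      by (intro ball_cong refl ex_QRr_iff) simp
    have 3: "(\<forall>a\<in>{1..<j}. \<exists>k\<in>{1..length l}. QRr r (part l k) = (q, s a))
        \<longleftrightarrow> (\<forall>a\<in>{1..<j}. r * q + s a \<in> set l)" if "j \<in> {1..t - 1}" for q j
      using that by (intro ball_cong refl ex_QRr_iff) simp
    have "l \<in> CP r t s \<longleftrightarrow> l \<in> CP_nodiv r \<and> (\<forall>i\<in>{1..length l}.
        (\<exists>j\<in>{1..t - 1}. part l i mod r = s j) \<and> ?cond2 i \<and> ?cond3 i)"
      unfolding CP_def mem_Collect_eq Rr_eq Qr_def
      by (intro conj_cong ball_cong imp_cong refl 2 3)
    then show ?thesis
      using nodiv A by blast
  qed
  show ?thesis
  proof
    assume l: "l \<in> CP r t s"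
    then have ?A and cond: "\<forall>i\<in>{1..length l}. ?cond2 i \<and> ?cond3 i"
      unfolding CP by (rule conjunct1, rule conjunct2)
    have c2: "?cond2 i" if "1 \<le> i" "i \<le> length l" for i
      by (rule bspec[OF cond, THEN conjunct1]) (use that in simp)
    have c3: "?cond3 i" if "1 \<le> i" "i \<le> length l" for i
      by (rule bspec[OF cond, THEN conjunct2]) (use that in simp)
    have ?B
    proof
      fix i assume "i \<in> {1..d}"
      then show "part l i mod r = s (t - 1)"
        using c2[of i] d(1) d(2)[of i] by simp
    qed
    moreover have ?C
    proof (intro allI impI ballI)
      fix q a assume "q < d" "a \<in> {1..<t - 1}"
      moreover from this have "Suc q \<le> part l (Suc q) div r" "Suc q \<le> length l"
        using d(1) d(2)[of "Suc q"] by simp_all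
      ultimately show "r * q + s a \<in> set l"
        using c2[of "Suc q"] by simp
    qed
    moreover have ?D
    proof (intro impI ballI)
      fix a assume D: "d < length l \<and> part l (Suc d) div r = d" and a: "a \<in> {1..t - 1}"
        and less: "s a < part l (Suc d) mod r"
      have "part l (Suc d) \<in> set l"
        using D by (intro part_in_set) simp
      then obtain j where j: "j \<in> {1..t - 1}" "part l (Suc d) mod r = s j"
        using \<open>?A\<close> by blast
      then have "a < j"
        using less a s_less_iff by simp
      have "?cond3 (Suc d)"
        using D by (intro c3) simp_all
      from bspec[OF this j(1)] have "\<forall>a\<in>{1..<j}. r * d + s a \<in> set l"
        using D j(2) by simp
      then show "r * d + s a \<in> set l"
        using a \<open>a < j\<close> by simp
    qed
    ultimately show "?A \<and> ?B \<and> ?C \<and> ?D"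
      using \<open>?A\<close> by blast
  next
    assume R: "?A \<and> ?B \<and> ?C \<and> ?D"
    have "?cond2 i \<and> ?cond3 i" if i: "i \<in> {1..length l}" for i
    proof (cases "i \<le> d")
      case True
      then have "i \<le> part l i div r" "i - 1 < d" "1 \<le> i"
        using d(2)[of i] i by auto
      then show ?thesis
        using R True by auto
    next
      case False
      then have le: "part l i div r \<le> d"
        using d(3)[of i] i by simp
      have "?cond2 i"
        using le False by simp
      moreover have "?cond3 i"
      proof (intro ballI impI)
        fix j a assume j: "j \<in> {1..t - 1}" "part l i div r = i - 1 \<and> part l i mod r = s j"
          and a: "a \<in> {1..<j}"
        then have "i = Suc d"
          using le False by simp
        moreover have "s a < s j"
          using a j(1) by (subst s_less_iff) auto
        ultimately show "r * (i - 1) + s a \<in> set l"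
          using R i j a by auto
      qed
      ultimately show ?thesis
        by blast
    qed
    then show "l \<in> CP r t s"
      using CP R by blast
  qed
qed

text \<open>The quotient is at least i for i <= d, and at most d < i - 1 for i > d + 1. Only the
  index d + 1 can have quotient i - 1.\<close>

lemma CP'_iff:
  assumes "durfee l d"
  shows "l \<in> CP' r t s \<longleftrightarrow> l \<in> CP r t s \<and> \<not> (d < length l \<and> part l (Suc d) div r = d)"
proof -
  have "(\<forall>i\<in>{1..length l}. part l i div r \<noteq> i - 1) \<longleftrightarrow> \<not> (d < length l \<and> part l (Suc d) div r = d)"
  proof
    assume *: "\<not> (d < length l \<and> part l (Suc d) div r = d)"
    show "\<forall>i\<in>{1..length l}. part l i div r \<noteq> i - 1"
    proof
      fix i assume i: "i \<in> {1..length l}"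
      consider "i \<le> d" | "i = Suc d" | "Suc d < i"
        by linarith
      then show "part l i div r \<noteq> i - 1"
      proof cases
        case 1
        then have "i \<le> part l i div r"
          using assms i by (simp add: durfee_def)
        then show ?thesis
          using i by auto
      next
        case 2
        then show ?thesis
          using * i by auto
      next
        case 3
        then have "part l i div r \<le> d"
          using assms i by (simp add: durfee_def)
        then show ?thesis
          using 3 by simp
      qed
    qed
  next
    assume "\<forall>i\<in>{1..length l}. part l i div r \<noteq> i - 1"
    from this[rule_format, of "Suc d"] show "\<not> (d < length l \<and> part l (Suc d) div r = d)"
      by auto
  qed
  then show ?thesis
    by (simp add: CP'_def Qr_def)
qed

text \<open>The first d parts have residue s_(t-1) already in CP, and beyond d + 1 the quotient is
  below i - 1; again the index d + 1 decides.\<close>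

lemma CP''_iff:
  assumes "durfee l d" "l \<in> CP r t s" "l \<in> partitions"
  shows "l \<in> CP'' r t s \<longleftrightarrow>
      (d < length l \<and> part l (Suc d) div r = d \<longrightarrow> part l (Suc d) mod r = s (t - 1))"
proof -
  have "(\<forall>i\<in>{1..length l}. i - 1 \<le> part l i div r \<longrightarrow> part l i mod r = s (t - 1)) \<longleftrightarrow>
      (d < length l \<and> part l (Suc d) div r = d \<longrightarrow> part l (Suc d) mod r = s (t - 1))"
  proof
    assume *: "d < length l \<and> part l (Suc d) div r = d \<longrightarrow> part l (Suc d) mod r = s (t - 1)"
    show "\<forall>i\<in>{1..length l}. i - 1 \<le> part l i div r \<longrightarrow> part l i mod r = s (t - 1)"
    proof (intro ballI impI)
      fix i assume i: "i \<in> {1..length l}" and le: "i - 1 \<le> part l i div r"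
      show "part l i mod r = s (t - 1)"
      proof (cases "i \<le> d")
        case True
        then show ?thesis
          using CP_iff[OF assms(3,1)] assms(2) i by auto
      next
        case False
        then have "part l i div r \<le> d"
          using assms(1) i by (simp add: durfee_def)
        with le False have "i = Suc d" "part l i div r = d"
          by auto
        then show ?thesis
          using * i by auto
      qed
    qed
  next
    assume "\<forall>i\<in>{1..length l}. i - 1 \<le> part l i div r \<longrightarrow> part l i mod r = s (t - 1)"
    from this[rule_format, of "Suc d"]
    show "d < length l \<and> part l (Suc d) div r = d \<longrightarrow> part l (Suc d) mod r = s (t - 1)"
      by auto
  qed
  then show ?thesis
    using assms(2) by (simp add: CP''_def Qr_def Rr_eq)
qed

section \<open>The map from configurations to CP\<close>

text \<open>Multiplicities of what is not absorbed by the large parts. The multiples of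
  \<open>t\<close> are absorbed entirely; the indices below \<open>t * d\<close> that precede a
  multiple of \<open>t\<close> are t q - 1 for q = 1, ..., d, and each gives one copy to the q-th
  large part.\<close>

definition rest :: "nat \<Rightarrow> (nat \<Rightarrow> nat) \<Rightarrow> nat \<Rightarrow> nat" where
  "rest d f i = (if t dvd i then 0 else if i < t * d \<and> t dvd Suc i then f i - 1 else f i)"

text \<open>The base r (i - 1) + s_(t-1) is \<open>psum (t * i - 1)\<close>, the copy removed by
  \<open>rest\<close>. The sum is the i-th part of the conjugate of the partition with
  \<open>f (t * q)\<close> parts equal to q.\<close>

definition head :: "nat \<Rightarrow> (nat \<Rightarrow> nat) \<Rightarrow> nat \<Rightarrow> nat" where
  "head d f i = r * (i - 1 + (\<Sum>q=i..d. f (t * q))) + s (t - 1)"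

definition tail :: "nat \<Rightarrow> (nat \<Rightarrow> nat) \<Rightarrow> nat list" where
  "tail h f = expand (rest (h div t) f) psum (rev [1..<Suc h])"

definition toCP :: "nat \<times> (nat \<Rightarrow> nat) \<Rightarrow> nat list" where
  "toCP = (\<lambda>(h, f). map (head (h div t) f) [1..<Suc (h div t)] @ tail h f)"

lemma head_div: "head d f i div r = i - 1 + (\<Sum>q=i..d. f (t * q))"
  and head_mod: "head d f i mod r = s (t - 1)"
  using s_last by (simp_all add: head_def)

lemma sorted_psum: "sorted_wrt (\<lambda>i j. psum j < psum i) (rev [1..<Suc h])"
  unfolding sorted_wrt_rev
  by (rule sorted_wrt_uptI) (simp add: strict_mono_less[OF psum_strict_mono])

lemma set_tail: "x \<in> set (tail h f) \<longleftrightarrow> (\<exists>i\<in>{1..h}. 0 < rest (h div t) f i \<and> x = psum i)"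
  unfolding tail_def set_expand set_rev set_upt atLeastLessThanSuc_atLeastAtMost
  by blast

text \<open>Valid also for \<open>i\<close> outside {1..h}, where both sides are 0; this lets
  injectivity compare \<open>rest\<close> at every index.\<close>

lemma count_tail:
  assumes "(h, f) \<in> conf n"
  shows "count_list (tail h f) (psum i) = rest (h div t) f i"
proof (cases "i \<in> {1..h}")
  case True
  then show ?thesis
    unfolding tail_def
    by (intro count_list_expand inj_on_if_sorted_wrt[OF sorted_psum]) auto
next
  case False
  then have "f i = 0"
    using conf_pos[OF assms, of i] by (metis atLeastAtMost_iff not_gr0)
  then have "rest (h div t) f i = 0"
    by (simp add: rest_def)
  moreover have "psum i \<notin> set (tail h f)"
    using False strict_mono_eq[OF psum_strict_mono] by (auto simp: set_tail)
  ultimately show ?thesis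
    by (simp add: count_notin)
qed

text \<open>Ensures that the wholly absorbed indices and those giving up one copy are
  disjoint.\<close>

lemma t_dvd_Suc: "t dvd Suc i \<Longrightarrow> \<not> t dvd i"
proof
  assume "t dvd Suc i" "t dvd i"
  then have "t dvd 1"
    using dvd_diff_nat[of t "Suc i" i] by simp
  then show False
    using t_ge by simp
qed

lemma sum_list_tail:
  assumes "(h, f) \<in> conf n"
  shows "sum_list (tail h f) = (\<Sum>i=1..h. rest (h div t) f i * psum i)"
proof -
  have "sum_list (tail h f) = sum_list (rev (map (\<lambda>i. rest (h div t) f i * psum i) [1..<Suc h]))"
    by (simp add: tail_def sum_list_expand rev_map del: upt_Suc)
  also have "\<dots> = sum_list (map (\<lambda>i. rest (h div t) f i * psum i) [1..<Suc h])"
    by (rule sum_list_rev)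
  finally show ?thesis
    by (simp only: interv_sum_list_conv_sum_set_nat set_upt atLeastLessThanSuc_atLeastAtMost)
qed

lemma sum_list_toCP:
  assumes "(h, f) \<in> conf n"
  shows "sum_list (toCP (h, f)) = n"
proof -
  define d where "d = h div t"
  define F where "F = (\<lambda>q. f (t * q))"
  have td: "t * d \<le> h" "h < t * Suc d"
    using t_ge dividend_less_times_div[of t h] by (simp_all add: d_def)
  have heads: "(\<Sum>i=1..d. head d f i) = (\<Sum>q=1..d. r * q * F q) + (\<Sum>i=1..d. r * (i - 1) + s (t - 1))"
  proof -
    \<comment> \<open>The factor i - (i - 1) = 1 is inserted to match summation by parts with the
      identity as weight.\<close>
    have "(\<Sum>i=1..d. head d f i)
        = (\<Sum>i=1..d. r * ((i - (i - 1)) * (\<Sum>q=i..d. F q)) + (r * (i - 1) + s (t - 1)))"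
    proof (rule sum.cong[OF refl])
      fix i assume "i \<in> {1..d}"
      then obtain m where "i = Suc m"
        by (cases i) auto
      then show "head d f i = r * ((i - (i - 1)) * (\<Sum>q=i..d. F q)) + (r * (i - 1) + s (t - 1))"
        by (simp add: head_def F_def add_mult_distrib2)
    qed
    also have "\<dots> = r * (\<Sum>i=1..d. (i - (i - 1)) * (\<Sum>q=i..d. F q)) + (\<Sum>i=1..d. r * (i - 1) + s (t - 1))"
      by (simp only: sum.distrib sum_distrib_left)
    also have "(\<Sum>i=1..d. (i - (i - 1)) * (\<Sum>q=i..d. F q)) = (\<Sum>q=1..d. q * F q)"
      by (rule sum_weighted_tails) simp_all
    finally show ?thesis
      by (simp only: sum_distrib_left mult.assoc)
  qed
  have mults: "(\<Sum>i=1..h. if t dvd i then psum i * f i else 0) = (\<Sum>q=1..d. r * q * F q)"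
  proof -
    have "{i \<in> {1..h}. t dvd i} = (\<lambda>q. t * q) ` {1..d}"
    proof (intro equalityI subsetI)
      fix i assume "i \<in> {i \<in> {1..h}. t dvd i}"
      then have i: "1 \<le> i" "i \<le> h" "t dvd i"
        by auto
      from i(3) obtain q where q: "i = t * q" ..
      have "1 \<le> q"
        using i(1) q by (cases q) auto
      moreover have "t * q < t * Suc d"
        using i(2) q td(2) by linarith
      then have "q < Suc d"
        by (rule mult_less_cancel1[THEN iffD1, THEN conjunct2])
      ultimately show "i \<in> (\<lambda>q. t * q) ` {1..d}"
        using q by (intro image_eqI[of _ _ q]) simp_all
    next
      fix i assume "i \<in> (\<lambda>q. t * q) ` {1..d}"
      then obtain q where q: "i = t * q" and "q \<in> {1..d}"
        by (rule imageE)
      then have "t * q \<le> t * d" "0 < t * q"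
        using t_ge by auto
      then have "i \<le> h" "1 \<le> i" "t dvd i"
        using q le_trans[OF _ td(1)] by simp_all
      then show "i \<in> {i \<in> {1..h}. t dvd i}"
        by simp
    qed
    moreover have "inj_on (\<lambda>q. t * q) {1..d}"
      using t_ge by (simp add: inj_on_def)
    ultimately have "(\<Sum>i | i \<in> {1..h} \<and> t dvd i. psum i * f i) = (\<Sum>q=1..d. psum (t * q) * f (t * q))"
      by (simp add: sum.reindex)
    then show ?thesis
      by (simp add: sum.inter_filter[symmetric] psum_mult F_def)
  qed
  \<comment> \<open>The copies given up, at the indices t i - 1 for i = 1, ..., d, are exactly the
    bases of the large parts.\<close>
  have tops: "(\<Sum>i=1..h. if i < t * d \<and> t dvd Suc i then psum i else 0) = (\<Sum>i=1..d. r * (i - 1) + s (t - 1))"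
  proof -
    let ?g = "\<lambda>i. t * (i - 1) + (t - 1)"
    have Suc_g: "Suc (?g i) = t * i" if "1 \<le> i" for i
    proof -
      have "t * i = t * (i - 1) + t"
        using that by (cases i) simp_all
      then show ?thesis
        using t_ge by simp
    qed
    have "{i \<in> {1..h}. i < t * d \<and> t dvd Suc i} = ?g ` {1..d}"
    proof (intro equalityI subsetI)
      fix i assume "i \<in> {i \<in> {1..h}. i < t * d \<and> t dvd Suc i}"
      then have i: "i < t * d" "t dvd Suc i"
        by auto
      from i(2) obtain q where q: "Suc i = t * q" ..
      have "1 \<le> q"
        using q by (cases q) auto
      moreover have "t * q < t * Suc d"
        using i(1) q t_ge by simp
      then have "q < Suc d"
        by (rule mult_less_cancel1[THEN iffD1, THEN conjunct2])
      moreover have "i = ?g q"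
        using Suc_g[OF \<open>1 \<le> q\<close>] q by simp
      ultimately show "i \<in> ?g ` {1..d}"
        by (intro image_eqI[of _ _ q]) simp_all
    next
      fix i assume "i \<in> ?g ` {1..d}"
      then obtain q where q: "i = ?g q" and "q \<in> {1..d}"
        by (rule imageE)
      then have "t * q \<le> t * d" "Suc i = t * q"
        using Suc_g[of q] by auto
      moreover have "1 \<le> i"
        using q(1) t_ge by simp
      moreover from calculation have "i < t * d" "i \<le> h"
        using td(1) by linarith+
      moreover have "t dvd Suc i"
        using \<open>Suc i = t * q\<close> by (rule dvdI)
      ultimately show "i \<in> {i \<in> {1..h}. i < t * d \<and> t dvd Suc i}"
        by simp
    qed
    moreover have "inj_on ?g {1..d}"
    proof (rule inj_onI)
      fix x y assume "x \<in> {1..d}" "y \<in> {1..d}" "?g x = ?g y"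
      then have "t * x = t * y"
        using Suc_g[of x] Suc_g[of y] by (metis atLeastAtMost_iff)
      then show "x = y"
        using t_ge by simp
    qed
    ultimately have "(\<Sum>i | i \<in> {1..h} \<and> i < t * d \<and> t dvd Suc i. psum i) = (\<Sum>i=1..d. psum (?g i))"
      by (simp add: sum.reindex)
    moreover have "psum (?g i) = r * (i - 1) + s (t - 1)" for i
      using t_ge by (intro psum_add) simp_all
    ultimately show ?thesis
      by (simp add: sum.inter_filter[symmetric])
  qed
  have "psum i * f i = rest d f i * psum i + (if t dvd i then psum i * f i else 0)
      + (if i < t * d \<and> t dvd Suc i then psum i else 0)" if "i \<in> {1..h}" for i
  proof -
    \<comment> \<open>Positivity makes the truncated \<open>f i - 1\<close> in \<open>rest\<close>
      an honest subtraction.\<close>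
    have "0 < f i"
      using that conf_pos[OF assms] by simp
    then obtain m where "f i = Suc m"
      by (cases "f i") auto
    then show ?thesis
      using t_dvd_Suc[of i] by (simp add: rest_def)
  qed
  then have "(\<Sum>i=1..h. psum i * f i) = (\<Sum>i=1..h. rest d f i * psum i + (if t dvd i then psum i * f i else 0)
      + (if i < t * d \<and> t dvd Suc i then psum i else 0))"
    by (rule sum.cong[OF refl])
  also have "\<dots> = sum_list (tail h f) + (\<Sum>i=1..d. head d f i)"
    unfolding sum.distrib mults tops heads sum_list_tail[OF assms] d_def[symmetric] by simp
  also have "\<dots> = sum_list (toCP (h, f))"
    by (simp add: toCP_def d_def[symmetric] interv_sum_list_conv_sum_set_nat
        atLeastLessThanSuc_atLeastAtMost del: upt_Suc)
  finally show ?thesis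
    using assms by (simp add: conf_def)
qed

context
  fixes h :: nat and f :: "nat \<Rightarrow> nat" and n d :: nat
  assumes conf: "(h, f) \<in> conf n" and n_pos: "0 < n" and d_def: "d = h div t"
begin

lemma td: "t * d \<le> h" "h < t * Suc d"
  using t_ge dividend_less_times_div[of t h] by (simp_all add: d_def)

lemma toCP_eq: "toCP (h, f) = map (head d f) [1..<Suc d] @ tail h f"
  by (simp add: toCP_def d_def)

lemma part_head: "i \<in> {1..d} \<Longrightarrow> part (toCP (h, f)) i = head d f i"
  by (auto simp: part_def toCP_eq nth_append simp del: upt_Suc)

lemma part_tail:
  assumes "i \<in> {d<..length (toCP (h, f))}"
  shows "part (toCP (h, f)) i \<in> set (tail h f)"
proof -
  have "part (toCP (h, f)) i = tail h f ! (i - 1 - d)"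
    using assms by (auto simp: part_def toCP_eq nth_append simp del: upt_Suc)
  then show ?thesis
    using assms by (auto simp: toCP_eq simp del: upt_Suc)
qed

lemma tail_elem:
  assumes "x \<in> set (tail h f)"
  obtains i where "1 \<le> i" "i \<le> h" "\<not> t dvd i" "x = psum i"
proof -
  obtain i where i: "i \<in> {1..h}" "0 < rest (h div t) f i" "x = psum i"
    using assms unfolding set_tail by blast
  moreover have "\<not> t dvd i"
    using i(2) by (auto simp: rest_def)
  ultimately show ?thesis
    using that[of i] by simp
qed

lemma f_mult_pos: "q \<in> {1..d} \<Longrightarrow> 1 \<le> f (t * q)"
proof -
  assume q: "q \<in> {1..d}"
  then have "t * q \<le> t * d" "1 \<le> t * q"
    using t_ge by (auto intro: Suc_leI)
  then have "t * q \<le> h" "1 \<le> t * q"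
    using td(1) by linarith+
  then show ?thesis
    using conf_pos[OF conf, of "t * q"] by simp
qed

text \<open>Passing from i to i + 1 adds 1 and loses \<open>f (t * i)\<close>, which is at least 1.
  The end point j = \<open>Suc d\<close>, with empty sum, gives the lower bound d for all head
  quotients.\<close>

lemma sum_head_mono:
  assumes "1 \<le> i" "i \<le> j" "j \<le> Suc d"
  shows "j - 1 + (\<Sum>q=j..d. f (t * q)) \<le> i - 1 + (\<Sum>q=i..d. f (t * q))"
  using assms(2,3)
proof (induction j rule: dec_induct)
  case (step j)
  have "(\<Sum>q=j..d. f (t * q)) = f (t * j) + (\<Sum>q=Suc j..d. f (t * q))"
    using step by (simp add: sum.atLeast_Suc_atMost)
  moreover have "1 \<le> f (t * j)"
    using step assms(1) by (intro f_mult_pos) simp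
  moreover have "j - 1 + (\<Sum>q=j..d. f (t * q)) \<le> i - 1 + (\<Sum>q=i..d. f (t * q))"
    using step by simp
  moreover have "1 \<le> j"
    using step assms(1) by simp
  ultimately show ?case
    by simp
qed simp

lemma head_ge: "i \<in> {1..d} \<Longrightarrow> d \<le> i - 1 + (\<Sum>q=i..d. f (t * q))"
  using sum_head_mono[of i "Suc d"] by simp

lemma head_antimono: "1 \<le> i \<Longrightarrow> i \<le> j \<Longrightarrow> j \<le> d \<Longrightarrow> head d f j \<le> head d f i"
  using sum_head_mono[of i j] unfolding head_def by (intro add_right_mono mult_le_mono2) simp_all

lemma durfee_toCP: "durfee (toCP (h, f)) d"
proof -
  have "d \<le> length (toCP (h, f))"
    by (simp add: toCP_eq)
  moreover have "i \<le> part (toCP (h, f)) i div r" if "i \<in> {1..d}" for i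
    unfolding part_head[OF that] head_div using head_ge[OF that] that by simp
  moreover have "part (toCP (h, f)) i div r \<le> d" if "i \<in> {d<..length (toCP (h, f))}" for i
  proof -
    from part_tail[OF that]
    obtain k where "1 \<le> k" "k \<le> h" "\<not> t dvd k" "part (toCP (h, f)) i = psum k"
      by (rule tail_elem)
    then show ?thesis
      by (simp add: psum_div d_def div_le_mono)
  qed
  ultimately show ?thesis
    unfolding durfee_def by blast
qed

lemma toCP_partitions: "toCP (h, f) \<in> partitions"
proof -
  have "toCP (h, f) \<noteq> []"
    using sum_list_toCP[OF conf] n_pos by auto
  moreover have "sorted_wrt (\<ge>) (toCP (h, f))"
  proof -
    have "sorted_wrt (\<ge>) (map (head d f) [1..<Suc d])"
      unfolding sorted_wrt_map by (rule sorted_wrt_uptI) (simp add: head_antimono)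
    moreover have "sorted_wrt (\<ge>) (tail h f)"
      unfolding tail_def by (rule sorted_expand[OF sorted_psum])
    moreover have "y \<le> head d f i" if "i \<in> {1..d}" "y \<in> set (tail h f)" for i y
    proof -
      from that(2) obtain k where k: "1 \<le> k" "k \<le> h" "\<not> t dvd k" "y = psum k"
        by (rule tail_elem)
      \<comment> \<open>The two lists meet at r d + s_(t-1): \<open>h\<close> is less than t (d +
        1), so no tail part exceeds this value, and every head has quotient at least d and residue
        s_(t-1).\<close>
      then have "k \<le> t * d + (t - 1)"
        using td(2) by simp
      then have "y \<le> r * d + s (t - 1)"
        using k(4) psum_add[of "t - 1" d] t_ge strict_mono_less_eq[OF psum_strict_mono, of k "t * d + (t - 1)"]
        by simp
      also have "\<dots> \<le> head d f i"
        unfolding head_def using head_ge[OF that(1)] by simp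
      finally show ?thesis .
    qed
    ultimately show ?thesis
      unfolding toCP_eq sorted_wrt_append set_map set_upt atLeastLessThanSuc_atLeastAtMost by blast
  qed
  moreover have "0 < x" if "x \<in> set (toCP (h, f))" for x
  proof -
    from that consider i where "x = head d f i" | "x \<in> set (tail h f)"
      unfolding toCP_eq set_append set_map by blast
    then show ?thesis
    proof cases
      case 1
      then show ?thesis
        using s_pos[of "t - 1"] t_ge by (simp add: head_def)
    next
      case 2
      then obtain i where "1 \<le> i" "i \<le> h" "\<not> t dvd i" "x = psum i"
        by (rule tail_elem)
      then show ?thesis
        using psum_pos[of i] by simp
    qed
  qed
  ultimately show ?thesis
    unfolding partitions_def by blast
qed

text \<open>At these indices no copy is given up, so \<open>rest\<close> agrees with
  \<open>f\<close> and is positive.\<close>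

lemma psum_in_toCP:
  assumes "\<not> t dvd i" "i \<le> h" "t * d < i \<or> \<not> t dvd Suc i"
  shows "psum i \<in> set (toCP (h, f))"
proof -
  have "1 \<le> i"
    using assms(1) by (cases i) auto
  then have "0 < rest (h div t) f i"
    using assms conf_pos[OF conf, of i] by (auto simp: rest_def d_def)
  then have "psum i \<in> set (tail h f)"
    unfolding set_tail using \<open>1 \<le> i\<close> assms(2) by auto
  then show ?thesis
    by (simp add: toCP_eq)
qed

lemma not_dvd_add: "1 \<le> a \<Longrightarrow> a < t \<Longrightarrow> \<not> t dvd t * q + a"
  by (simp add: dvd_eq_mod_eq_0)

text \<open>The quotient of \<open>psum i\<close> is \<open>i div t\<close>, so a tail part with
  quotient d has its index in the last, incomplete block of indices.\<close>

lemma next_part: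
  assumes "d < length (toCP (h, f))" "part (toCP (h, f)) (Suc d) div r = d"
  obtains i where "i \<le> h" "i = t * d + i mod t" "1 \<le> i mod t" "i mod t \<le> t - 1"
    "part (toCP (h, f)) (Suc d) = psum i"
proof -
  have "part (toCP (h, f)) (Suc d) \<in> set (tail h f)"
    using assms by (intro part_tail) simp
  then obtain i where i: "1 \<le> i" "i \<le> h" "\<not> t dvd i" "part (toCP (h, f)) (Suc d) = psum i"
    by (rule tail_elem)
  then have "i div t = d"
    using assms(2) psum_div by simp
  then have "i = t * d + i mod t"
    using mult_div_mod_eq[of t i] by simp
  then show ?thesis
    using that[of i] i(2,4) mod_range[OF i(3)] by simp
qed

lemma toCP_CP: "toCP (h, f) \<in> CP r t s"
  unfolding CP_iff[OF toCP_partitions durfee_toCP]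
proof (intro conjI ballI allI impI)
  fix x assume "x \<in> set (toCP (h, f))"
  then consider i where "x = head d f i" | "x \<in> set (tail h f)"
    unfolding toCP_eq set_append set_map by blast
  then show "\<exists>j\<in>{1..t - 1}. x mod r = s j"
  proof cases
    case 1
    then show ?thesis
      using t_ge by (intro bexI[of _ "t - 1"]) (simp_all add: head_mod)
  next
    case 2
    then obtain i where "1 \<le> i" "i \<le> h" "\<not> t dvd i" "x = psum i"
      by (rule tail_elem)
    then show ?thesis
      using mod_range[of i] by (intro bexI[of _ "i mod t"]) (simp_all add: psum_mod)
  qed
next
  fix i assume "i \<in> {1..d}"
  then show "part (toCP (h, f)) i mod r = s (t - 1)"
    by (simp add: part_head head_mod)
next
  \<comment> \<open>For a < t - 1 the index t q + a does not precede a multiple of t, so the part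
    required by condition (2) keeps all its copies.\<close>
  fix q a assume "q < d" and a: "a \<in> {1..<t - 1}"
  then have "t * Suc q \<le> t * d"
    by (intro mult_le_mono) simp_all
  moreover have "1 \<le> a" "Suc a < t" "a < t"
    using a unfolding atLeastLessThan_iff by linarith+
  ultimately have "t * q + a \<le> h"
    using td(1) unfolding mult_Suc_right by linarith
  moreover have "\<not> t dvd t * q + a" "\<not> t dvd t * q + Suc a"
    using \<open>1 \<le> a\<close> \<open>Suc a < t\<close> by (intro not_dvd_add; simp)+
  ultimately have "psum (t * q + a) \<in> set (toCP (h, f))"
    by (intro psum_in_toCP) simp_all
  then show "r * q + s a \<in> set (toCP (h, f))"
    using psum_add[of a q] a by simp
next
  \<comment> \<open>Part d + 1 has an index up to \<open>h\<close> in the last block. A smaller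
    residue belongs to a smaller index of that block, where \<open>f\<close> is positive and nothing
    is given up.\<close>
  fix a assume *: "d < length (toCP (h, f)) \<and> part (toCP (h, f)) (Suc d) div r = d"
    and a: "a \<in> {1..t - 1}" and less: "s a < part (toCP (h, f)) (Suc d) mod r"
  obtain i where i: "i \<le> h" "i = t * d + i mod t" "1 \<le> i mod t" "i mod t \<le> t - 1"
    "part (toCP (h, f)) (Suc d) = psum i"
    using *[THEN conjunct1] *[THEN conjunct2] by (rule next_part)
  have "\<not> t dvd i"
    using i(3) by (auto simp: dvd_eq_mod_eq_0)
  then have "a < i mod t"
    using less a i(3,4) s_less_iff[of a "i mod t"] unfolding i(5) psum_mod by simp
  then have "t * d + a \<le> h"
    using i(1,2) by linarith
  moreover have "\<not> t dvd t * d + a"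
    using a t_ge by (intro not_dvd_add) auto
  ultimately have "psum (t * d + a) \<in> set (toCP (h, f))"
    using a by (intro psum_in_toCP) simp_all
  then show "r * d + s a \<in> set (toCP (h, f))"
    using psum_add[of a d] a by simp
qed

lemma h_mod: "h = t * d + h mod t"
  by (simp add: d_def)

text \<open>\<open>h\<close> is the largest index and lies beyond t d, so it gives up no copy and
  \<open>psum h\<close> opens the tail.\<close>

lemma toCP_next_part:
  assumes "h mod t \<noteq> 0"
  shows "d < length (toCP (h, f))" "part (toCP (h, f)) (Suc d) = psum h"
proof -
  have h: "1 \<le> h" "t * d < h" "\<not> t dvd h"
    using assms h_mod by (auto simp: dvd_eq_mod_eq_0 intro: Suc_leI)
  then have "0 < rest (h div t) f h"
    using conf_pos[OF conf, of h] by (simp add: rest_def d_def)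
  then obtain m where m: "rest (h div t) f h = Suc m"
    by (cases "rest (h div t) f h") auto
  have "rev [1..<Suc h] = h # rev [1..<h]"
    using h(1) by simp
  then have "tail h f = psum h # replicate m (psum h) @ expand (rest (h div t) f) psum (rev [1..<h])"
    unfolding tail_def using m by simp
  then show "d < length (toCP (h, f))" "part (toCP (h, f)) (Suc d) = psum h"
    by (simp_all add: toCP_eq part_def nth_append del: upt_Suc)
qed

text \<open>If t divides h, then h = t d and the last block holds no index. Thus part d + 1 reveals
  \<open>h mod t\<close>, as the length does on the RP side.\<close>

lemma toCP_next_part_iff:
  "d < length (toCP (h, f)) \<and> part (toCP (h, f)) (Suc d) div r = d \<longleftrightarrow> h mod t \<noteq> 0"
proof
  assume *: "d < length (toCP (h, f)) \<and> part (toCP (h, f)) (Suc d) div r = d"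
  obtain i where "i \<le> h" "i = t * d + i mod t" "1 \<le> i mod t" "i mod t \<le> t - 1"
    "part (toCP (h, f)) (Suc d) = psum i"
    using *[THEN conjunct1] *[THEN conjunct2] by (rule next_part)
  then show "h mod t \<noteq> 0"
    using h_mod by linarith
next
  assume "h mod t \<noteq> 0"
  then show "d < length (toCP (h, f)) \<and> part (toCP (h, f)) (Suc d) div r = d"
    using toCP_next_part by (simp add: psum_div d_def)
qed

lemma toCP_CP': "toCP (h, f) \<in> CP' r t s \<longleftrightarrow> h mod t = 0"
  unfolding CP'_iff[OF durfee_toCP] toCP_next_part_iff using toCP_CP by simp

lemma toCP_CP'': "toCP (h, f) \<in> CP'' r t s \<longleftrightarrow> h mod t = 0 \<or> h mod t = t - 1"
proof (cases "h mod t = 0")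
  case False
  then have "\<not> t dvd h"
    by (simp add: dvd_eq_mod_eq_0)
  then show ?thesis
    using toCP_next_part(2)[OF False] False mod_range[of h] s_eq_iff[of "h mod t" "t - 1"] t_ge
    unfolding CP''_iff[OF durfee_toCP toCP_CP toCP_partitions] toCP_next_part_iff
    by (simp add: psum_mod)
qed (simp add: CP''_iff[OF durfee_toCP toCP_CP toCP_partitions] toCP_next_part_iff)

end

section \<open>Inverting the map to CP\<close>

text \<open>Uniqueness of the Durfee square gives a common d, which cuts both lists at the same
  place. Head quotients then determine \<open>f\<close> on the multiples of t, tail multiplicities
  determine it elsewhere.\<close>

lemma toCP_inj:
  assumes "0 < n"
  shows "inj_on toCP (conf n)"
proof (rule inj_onI, clarify)
  fix h f h' f'
  assume c: "(h, f) \<in> conf n" "(h', f') \<in> conf n" and eq: "toCP (h, f) = toCP (h', f')"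
  define d where "d = h div t"
  have d': "d = h' div t"
    using durfee_unique[OF durfee_toCP[OF c(1) assms refl] durfee_toCP[OF c(2) assms refl, folded eq]]
    by (simp add: d_def)
  have heads: "head d f i = head d f' i" if "i \<in> {1..d}" for i
    using part_head[OF c(1) assms d_def that] part_head[OF c(2) assms d' that] eq by simp
  have mult_eq: "f (t * q) = f' (t * q)" if "1 \<le> q" "q \<le> d" for q
  proof (rule sum_tail_eqD[of 1 d "\<lambda>q. f (t * q)" "\<lambda>q. f' (t * q)", OF _ that])
    fix i assume "1 \<le> i" "i \<le> d"
    then have "head d f i div r = head d f' i div r"
      using heads[of i] by simp
    then show "(\<Sum>q=i..d. f (t * q)) = (\<Sum>q=i..d. f' (t * q))"
      by (simp add: head_div)
  qed
  have "tail h f = tail h' f'"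
    using eq toCP_eq[OF c(1) assms d_def] toCP_eq[OF c(2) assms d'] by simp
  then have rest_eq: "rest d f i = rest d f' i" for i
    using count_tail[OF c(1), of i] count_tail[OF c(2), of i] d' by (simp add: d_def)
  have "f i = f' i" for i
  proof (cases "t dvd i")
    case True
    then obtain q where q: "i = t * q" ..
    consider "q = 0" | "1 \<le> q" "q \<le> d" | "Suc d \<le> q"
      by linarith
    then show ?thesis
    proof cases
      case 1
      then show ?thesis
        using q conf_pos[OF c(1), of 0] conf_pos[OF c(2), of 0] by simp
    next
      case 2
      then show ?thesis
        using q mult_eq by simp
    next
      case 3
      then have "t * Suc d \<le> i"
        unfolding q by (rule mult_le_mono2)
      then have "h < i" "h' < i"
        using td(2)[OF c(1) assms d_def] td(2)[OF c(2) assms d'] by linarith+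
      then show ?thesis
        using conf_pos[OF c(1), of i] conf_pos[OF c(2), of i] by simp
    qed
  next
    case False
    show ?thesis
    proof (cases "i < t * d \<and> t dvd Suc i")
      case True
      \<comment> \<open>Here \<open>rest\<close> yields only \<open>f i - 1\<close>, so both values
        of \<open>f\<close> must be known to be positive; this holds as i < t d is within both
        ranges.\<close>
      have "1 \<le> i"
        using False by (cases i) auto
      moreover have "i \<le> h" "i \<le> h'"
        using True td(1)[OF c(1) assms d_def] td(1)[OF c(2) assms d'] by linarith+
      ultimately have "0 < f i" "0 < f' i"
        using conf_pos[OF c(1), of i] conf_pos[OF c(2), of i] by simp_all
      moreover have "f i - 1 = f' i - 1"
        using rest_eq[of i] False True by (simp add: rest_def)
      ultimately show ?thesis
        by linarith
    next
      case not_top: False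
      then show ?thesis
        using rest_eq[of i] False unfolding rest_def by (simp only: if_False)
    qed
  qed
  then have "f = f'"
    by (rule ext)
  then show "h = h' \<and> f = f'"
    using conf_h_unique c by blast
qed

lemma toCP_surj:
  assumes "l \<in> of_size (CP r t s) n" "0 < n"
  shows "l \<in> toCP ` conf n"
proof -
  have CP: "l \<in> CP r t s" and l: "l \<in> partitions" and sum: "sum_list l = n"
    using assms by (simp_all add: of_size_def)
  have sorted: "sorted_wrt (\<ge>) l"
    using l by (simp add: partitions_def)
  obtain d where durfee: "durfee l d"
    using durfee_ex[OF sorted] .
  have d_le: "d \<le> length l"
    and up: "\<And>i. 1 \<le> i \<Longrightarrow> i \<le> d \<Longrightarrow> i \<le> part l i div r"
    and low: "\<And>i. d < i \<Longrightarrow> i \<le> length l \<Longrightarrow> part l i div r \<le> d"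
    using durfee by (simp_all add: durfee_def)
  note props = CP[unfolded CP_iff[OF l durfee]]
  have A: "\<exists>j\<in>{1..t - 1}. x mod r = s j" if "x \<in> set l" for x
    using props[THEN conjunct1] that by (rule bspec)
  have B: "part l i mod r = s (t - 1)" if "i \<in> {1..d}" for i
    using props[THEN conjunct2, THEN conjunct1] that by (rule bspec)
  have C: "r * q + s a \<in> set l" if "q < d" "a \<in> {1..<t - 1}" for q a
    using props[THEN conjunct2, THEN conjunct2, THEN conjunct1, rule_format, OF that] .
  have D: "r * d + s a \<in> set l"
    if "d < length l" "part l (Suc d) div r = d" "a \<in> {1..t - 1}" "s a < part l (Suc d) mod r" for a
    using props[THEN conjunct2, THEN conjunct2, THEN conjunct2, rule_format, OF conjI[OF that(1,2)] that(3,4)] .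
  let ?next = "d < length l \<and> part l (Suc d) div r = d"
  \<comment> \<open>\<open>h\<close> must be the largest index in use. If part d + 1 has quotient d,
    it has to be \<open>psum h\<close>, and j indexes its residue; otherwise no part after the first
    d has quotient d, and h = t d.\<close>
  obtain j where j: "j < t" "?next \<Longrightarrow> 1 \<le> j \<and> part l (Suc d) mod r = s j" "\<not> ?next \<Longrightarrow> j = 0"
  proof (cases ?next)
    case True
    then have "part l (Suc d) \<in> set l"
      by (intro part_in_set) simp
    then obtain j where "j \<in> {1..t - 1}" "part l (Suc d) mod r = s j"
      using A by blast
    moreover from this have "j < t"
      using t_ge by auto
    ultimately show ?thesis
      using True that[of j] by simp
  next
    case False
    then show ?thesis
      using t_ge by (intro that[of 0]) simp_all
  qed
  define h where "h = t * d + j"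
  have h_div: "h div t = d"
    using j(1) by (simp add: h_def)
  let ?T = "drop d l"
  have T_part: "\<exists>k. d < k \<and> k \<le> length l \<and> x = part l k" if "x \<in> set ?T" for x
  proof -
    from that obtain m where "m < length ?T" "?T ! m = x"
      unfolding in_set_conv_nth by blast
    then have "m < length l - d" "x = l ! (d + m)"
      using d_le by simp_all
    then show ?thesis
      by (intro exI[of _ "Suc (d + m)"]) (simp add: part_def)
  qed
  have part_T: "part l k \<in> set ?T" if "d < k" "k \<le> length l" for k
    using that d_le by (auto simp: in_set_conv_nth part_def intro!: exI[of _ "k - Suc d"])
  \<comment> \<open>Membership in \<open>l\<close> must be sharpened to membership among the parts
    after the first d: those first parts all have quotient at least d.\<close>
  have T_quot: "x \<in> set ?T" if "x \<in> set l" "x div r < d" for x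
  proof -
    obtain k where k: "1 \<le> k" "k \<le> length l" "part l k = x"
      using \<open>x \<in> set l\<close> unfolding in_set_part by auto
    have "\<not> k \<le> d"
    proof
      assume "k \<le> d"
      then have "part l d div r \<le> part l k div r"
        using k d_le by (intro div_le_mono part_antimono[OF sorted])
      moreover have "d \<le> part l d div r"
        using up[of d] \<open>k \<le> d\<close> k(1) by simp
      ultimately show False
        using that(2) k(3) by simp
    qed
    then show ?thesis
      using part_T[of k] k by simp
  qed
  have T_less: "x \<in> set ?T" if "x \<in> set l" "d < length l" "x < part l (Suc d)" for x
  proof -
    obtain k where k: "1 \<le> k" "k \<le> length l" "part l k = x"
      using \<open>x \<in> set l\<close> unfolding in_set_part by auto
    have "\<not> k \<le> d"
    proof
      assume "k \<le> d"
      then have "part l (Suc d) \<le> part l k"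
        using k that(2) by (intro part_antimono[OF sorted]) simp_all
      then show False
        using that(3) k(3) by simp
    qed
    then show ?thesis
      using part_T[of k] k by simp
  qed
  \<comment> \<open>Removing the offset q - 1 from the q-th quotient leaves the prospective tail sum
    of the values \<open>f (t * q)\<close>; it is 0 beyond d so that the differences
    telescope.\<close>
  define K where "K q = (if q \<le> d then part l q div r + 1 - q else 0)" for q
  have K_dec: "K (Suc q) < K q" if "1 \<le> q" "q \<le> d" for q
  proof (cases "Suc q \<le> d")
    case True
    then have "part l (Suc q) div r \<le> part l q div r"
      using that d_le by (intro div_le_mono part_antimono[OF sorted]) simp_all
    then show ?thesis
      using up[OF that] True that by (simp add: K_def)
  next
    case False
    then show ?thesis
      using up[OF that] that by (simp add: K_def)
  qed
  define c where "c i = count_list ?T (psum i)" for i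
  \<comment> \<open>This reverses the construction: differences of \<open>K\<close> on the multiples
    of t, observed multiplicities elsewhere, with the copy used as a base put back.\<close>
  define f where "f i = (if i = 0 \<or> h < i then 0 else
      if t dvd i then K (i div t) - K (Suc (i div t)) else
      c i + (if i < t * d \<and> t dvd Suc i then 1 else 0))" for i
  \<comment> \<open>Where no copy is put back, positivity of \<open>f\<close> needs an actual
    occurrence. \<open>C\<close> supplies it in the blocks q < d. In the last block, part d + 1
    serves for the index \<open>h\<close>, and \<open>D\<close> for the smaller ones.\<close>
  have psum_in: "psum i \<in> set ?T" if "1 \<le> i" "i \<le> h" "\<not> t dvd i" "\<not> (i < t * d \<and> t dvd Suc i)" for i
  proof -
    define q a where "q = i div t" and "a = i mod t"
    have i: "i = t * q + a" and a: "1 \<le> a" "a \<le> t - 1"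
      using mod_range[OF that(3)] by (simp_all add: q_def a_def)
    have "q \<le> d"
      using div_le_mono[OF that(2), of t] by (simp add: h_div q_def)
    have ps: "psum i = r * q + s a"
      using psum_add[OF a, of q] i by simp
    have ps_div: "psum i div r = q"
      by (simp add: psum_div q_def)
    show ?thesis
    proof (cases "q < d")
      case True
      then have "t * Suc q \<le> t * d"
        by (intro mult_le_mono2) simp
      then have "t * q + t \<le> t * d"
        by simp
      then have "i < t * d"
        using i a t_ge by linarith
      then have "\<not> t dvd Suc i"
        using that(4) by simp
      have "a \<noteq> t - 1"
      proof
        assume "a = t - 1"
        then have "Suc i = t * Suc q"
          using i t_ge by simp
        then show False
          using \<open>\<not> t dvd Suc i\<close> by simp
      qed
      then have "psum i \<in> set l"
        using C[OF True, of a] a ps by simp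
      then show ?thesis
        using T_quot True ps_div by simp
    next
      case False
      then have "q = d"
        using \<open>q \<le> d\<close> by simp
      then have "a \<le> j"
        using that(2) i by (simp add: h_def)
      then have "?next"
        using a(1) j(3) by fastforce
      note nx = this[THEN conjunct1] this[THEN conjunct2] j(2)[OF this]
      have first: "part l (Suc d) = r * d + s j"
        using nx(2,3) mult_div_mod_eq[of r "part l (Suc d)"] by simp
      show ?thesis
      proof (cases "a = j")
        case True
        then show ?thesis
          using part_T[of "Suc d"] nx(1) first ps \<open>q = d\<close> by simp
      next
        case False
        then have "s a < s j"
          using a \<open>a \<le> j\<close> j(1) by (subst s_less_iff) auto
        then have "r * d + s a \<in> set l" "r * d + s a < part l (Suc d)"
          using D[OF nx(1,2), of a] a nx(3) first by simp_all
        then show ?thesis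
          using T_less[OF _ nx(1)] ps \<open>q = d\<close> by simp
      qed
    qed
  qed
  have fpos: "0 < f i \<longleftrightarrow> i \<in> {1..h}" for i
  proof (cases "i = 0 \<or> h < i")
    case True
    then show ?thesis
      by (auto simp: f_def)
  next
    case False
    then have i: "1 \<le> i" "i \<le> h"
      by auto
    have "0 < f i"
    proof (cases "t dvd i")
      case True
      then have "1 \<le> i div t"
        using i(1) t_ge by (auto elim!: dvdE simp: Suc_le_eq)
      moreover have "i div t \<le> d"
        using div_le_mono[OF i(2), of t] by (simp add: h_div)
      ultimately show ?thesis
        using K_dec[of "i div t"] True False by (simp add: f_def)
    next
      case ndvd: False
      show ?thesis
      proof (cases "i < t * d \<and> t dvd Suc i")
        case True
        then show ?thesis
          using ndvd False by (simp add: f_def)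
      next
        case ntop: False
        then have "0 < c i"
          using psum_in[OF i ndvd ntop] count_list_0_iff[of ?T "psum i"] unfolding c_def by simp
        then show ?thesis
          using ndvd False by (simp add: f_def)
      qed
    qed
    then show ?thesis
      using i by simp
  qed
  \<comment> \<open>As for RP, the weighted sum is named first and identified with \<open>n\<close>
    only after \<open>toCP (h, f)\<close> has been computed.\<close>
  define n' where "n' = (\<Sum>i=1..h. psum i * f i)"
  have conf: "(h, f) \<in> conf n'"
    using fpos by (simp add: conf_def n'_def)
  have T_sub: "set ?T \<subseteq> psum ` {1..h}"
  proof
    fix x assume x: "x \<in> set ?T"
    then obtain k where k: "d < k" "k \<le> length l" "x = part l k"
      using T_part by blast
    have "x \<in> set l"
      using x by (rule in_set_dropD)
    then obtain a where a: "a \<in> {1..t - 1}" "x mod r = s a"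
      using A by blast
    have x_eq: "x = r * (x div r) + s a"
      using a(2) mult_div_mod_eq[of r x] by simp
    then have x_psum: "x = psum (t * (x div r) + a)"
      using psum_add[of a "x div r"] a(1) by simp
    \<comment> \<open>Smaller quotients are clear. For quotient d, x is at most part d + 1 = r d +
      s_j, so comparing residues bounds a by j.\<close>
    have "t * (x div r) + a \<le> h"
    proof (cases "x div r < d")
      case True
      then have "t * Suc (x div r) \<le> t * d"
        by (intro mult_le_mono2) simp
      then have "t * (x div r) + t \<le> t * d"
        by simp
      moreover have "a < t"
        using a(1) t_ge by auto
      ultimately show ?thesis
        unfolding h_def by linarith
    next
      case False
      then have xd: "x div r = d"
        using low[OF k(1,2)] k(3) by simp
      have len: "d < length l"
        using k by simp
      have le: "x \<le> part l (Suc d)"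
        unfolding k(3) using k by (intro part_antimono[OF sorted]) simp_all
      then have "d \<le> part l (Suc d) div r"
        using div_le_mono[of x "part l (Suc d)" r] xd by simp
      then have first_div: "part l (Suc d) div r = d"
        using low[of "Suc d"] len by simp
      then have first: "1 \<le> j" "part l (Suc d) mod r = s j"
        using j(2) len by simp_all
      have "part l (Suc d) = r * d + s j"
        using first_div first(2) mult_div_mod_eq[of r "part l (Suc d)"] by simp
      then have "s a \<le> s j"
        using le x_eq xd by simp
      then have "\<not> j < a"
        using s_less_iff[of j a] a(1) first(1) j(1) by auto
      then show ?thesis
        using xd by (simp add: h_def)
    qed
    then show "x \<in> psum ` {1..h}"
      using a(1) x_psum by (intro image_eqI[of _ _ "t * (x div r) + a"]) simp_all
  qed
  have tail: "tail h f = ?T"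
    unfolding tail_def
  proof (rule expand_eq[OF _ sorted_psum])
    show "sorted_wrt (\<ge>) ?T"
      using sorted by (rule sorted_wrt_drop)
    show "set ?T \<subseteq> psum ` set (rev [1..<Suc h])"
      using T_sub unfolding set_rev set_upt atLeastLessThanSuc_atLeastAtMost .
    fix i assume "i \<in> set (rev [1..<Suc h])"
    then have i: "1 \<le> i" "i \<le> h"
      unfolding set_rev set_upt by simp_all
    show "rest (h div t) f i = count_list ?T (psum i)"
    proof (cases "t dvd i")
      case True
      \<comment> \<open>For t dividing i, \<open>psum i\<close> is a multiple of r, whereas all
        parts have a positive residue s_a.\<close>
      have "psum i \<notin> set ?T"
      proof
        assume "psum i \<in> set ?T"
        then have "psum i \<in> set l"
          by (rule in_set_dropD)
        then obtain a where "a \<in> {1..t - 1}" "psum i mod r = s a"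
          using A by blast
        then show False
          using True s_pos[of a] by (simp add: psum_mod)
      qed
      then show ?thesis
        using True by (simp add: rest_def count_notin)
    next
      case False
      then show ?thesis
        using i by (simp add: rest_def f_def h_div c_def)
    qed
  qed
  have tails: "(\<Sum>q=i..d. f (t * q)) = K i" if "1 \<le> i" "i \<le> d" for i
  proof -
    have "(\<Sum>q=i..d. f (t * q)) = (\<Sum>q=i..d. K q - K (Suc q))"
    proof (rule sum.cong[OF refl])
      fix q assume q: "q \<in> {i..d}"
      then have "t * q \<le> t * d"
        by simp
      then have "t * q \<le> h"
        unfolding h_def by (rule trans_le_add1)
      moreover have "0 < t * q"
        using q that(1) t_ge by simp
      ultimately show "f (t * q) = K q - K (Suc q)"
        using t_ge by (simp add: f_def)
    qed
    also have "\<dots> = K i - K (Suc d)"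
      using that by (intro sum_telescope_nat) (auto intro!: less_imp_le[OF K_dec])
    also have "\<dots> = K i"
      by (simp add: K_def)
    finally show ?thesis .
  qed
  have "map (head d f) [1..<Suc d] = take d l"
  proof (rule nth_equalityI)
    show "length (map (head d f) [1..<Suc d]) = length (take d l)"
      using d_le by simp
    fix k assume "k < length (map (head d f) [1..<Suc d])"
    then have k: "k < d"
      by (simp del: upt_Suc)
    have "head d f (Suc k) = r * (k + K (Suc k)) + s (t - 1)"
      using tails[of "Suc k"] k by (simp add: head_def)
    also have "k + K (Suc k) = part l (Suc k) div r"
      using up[of "Suc k"] k by (simp add: K_def)
    also have "r * (part l (Suc k) div r) + s (t - 1) = part l (Suc k)"
      using B[of "Suc k"] k mult_div_mod_eq[of r "part l (Suc k)"] by simp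
    finally show "map (head d f) [1..<Suc d] ! k = take d l ! k"
      using k by (simp add: part_def del: upt_Suc)
  qed
  then have toCP: "toCP (h, f) = l"
    using tail by (simp add: toCP_def h_div del: upt_Suc)
  then have "n' = n"
    using sum_list_toCP[OF conf] sum by simp
  then show ?thesis
    using conf toCP by (metis image_eqI)
qed

lemma toCP_bij: "0 < n \<Longrightarrow> bij_betw toCP (conf n) (of_size (CP r t s) n)"
  unfolding bij_betw_def
proof (intro conjI equalityI subsetI)
  assume n: "0 < n"
  show "inj_on toCP (conf n)"
    using n by (rule toCP_inj)
  fix l assume "l \<in> toCP ` conf n"
  then obtain h f where "(h, f) \<in> conf n" "l = toCP (h, f)"
    by auto
  then show "l \<in> of_size (CP r t s) n"
    using toCP_CP[OF _ n refl] toCP_partitions[OF _ n refl] sum_list_toCP by (simp add: of_size_def)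
qed (rule toCP_surj)

section \<open>The primed subsets and the cardinalities\<close>

text \<open>The length is \<open>psum h\<close>, whose residue modulo r is 0 exactly when t divides
  h, all s_j being strictly between 0 and r.\<close>

lemma toRP_RP': "toRP (h, f) \<in> RP r t s \<Longrightarrow> toRP (h, f) \<in> RP' r t s \<longleftrightarrow> h mod t = 0"
proof (cases "t dvd h")
  case False
  then have "0 < s (h mod t)"
    using mod_range[of h] s_pos[of "h mod t"] by simp
  then show "toRP (h, f) \<in> RP r t s \<Longrightarrow> ?thesis"
    using False by (simp add: RP'_def length_toRP cong_def psum_mod dvd_eq_mod_eq_0)
qed (simp add: RP'_def length_toRP cong_def psum_mod)

lemma toRP_RP'':
  "toRP (h, f) \<in> RP r t s \<Longrightarrow> toRP (h, f) \<in> RP'' r t s \<longleftrightarrow> h mod t = 0 \<or> h mod t = t - 1"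
proof (cases "t dvd h")
  case False
  then have "0 < s (h mod t)" "s (h mod t) = s (t - 1) \<longleftrightarrow> h mod t = t - 1"
    using mod_range[of h] s_pos[of "h mod t"] t_ge by (simp_all add: s_eq_iff)
  then show "toRP (h, f) \<in> RP r t s \<Longrightarrow> ?thesis"
    using False s_last by (simp add: RP''_def length_toRP cong_def psum_mod dvd_eq_mod_eq_0)
qed (simp add: RP''_def length_toRP cong_def psum_mod)

text \<open>A single predicate on \<open>h\<close> cuts out both subsets, so both are injective
  images of the same set of configurations. The three equalities differ only in the choice of
  \<open>P\<close>.\<close>

lemma card_eq:
  assumes "0 < n" "Y \<subseteq> CP r t s" "X \<subseteq> RP r t s"
    and Y: "\<And>h f. (h, f) \<in> conf n \<Longrightarrow> toCP (h, f) \<in> Y \<longleftrightarrow> P h"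
    and X: "\<And>h f. (h, f) \<in> conf n \<Longrightarrow> toRP (h, f) \<in> X \<longleftrightarrow> P h"
  shows "card (of_size Y n) = card (of_size X n)"
proof -
  let ?C = "{c \<in> conf n. P (fst c)}"
  have "card (of_size Z n) = card ?C"
    if "bij_betw g (conf n) (of_size U n)" "Z \<subseteq> U" "\<And>h f. (h, f) \<in> conf n \<Longrightarrow> g (h, f) \<in> Z \<longleftrightarrow> P h"
    for g Z U
  proof -
    have "of_size Z n = {l \<in> of_size U n. l \<in> Z}"
      using that(2) by (auto simp: of_size_def)
    also have "\<dots> = g ` ?C"
      unfolding bij_betw_imp_surj_on[OF that(1), symmetric] using that(3) by auto
    finally show ?thesis
      using card_image[OF inj_on_subset[OF bij_betw_imp_inj_on[OF that(1)], of ?C]] by simp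
  qed
  from this[OF toCP_bij[OF assms(1)] assms(2) Y] this[OF toRP_bij[OF assms(1)] assms(3) X]
  show ?thesis
    by simp
qed

lemma card_CP_RP:
  assumes "0 < n"
  shows "card (of_size (CP r t s) n) = card (of_size (RP r t s) n)"
    and "card (of_size (CP' r t s) n) = card (of_size (RP' r t s) n)"
    and "card (of_size (CP'' r t s) n) = card (of_size (RP'' r t s) n)"
proof -
  have RP: "toRP (h, f) \<in> RP r t s" if "(h, f) \<in> conf n" for h f
    using toRP_in[OF that assms] by (simp add: of_size_def)
  show "card (of_size (CP r t s) n) = card (of_size (RP r t s) n)"
    by (rule card_eq[where P = "\<lambda>_. True", OF assms]) (simp_all add: RP toCP_CP[OF _ assms refl])
  show "card (of_size (CP' r t s) n) = card (of_size (RP' r t s) n)"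
  proof (rule card_eq[where P = "\<lambda>h. h mod t = 0", OF assms])
    show "CP' r t s \<subseteq> CP r t s" "RP' r t s \<subseteq> RP r t s"
      by (simp_all add: CP'_def RP'_def)
  qed (simp_all add: toCP_CP'[OF _ assms refl] toRP_RP'[OF RP])
  show "card (of_size (CP'' r t s) n) = card (of_size (RP'' r t s) n)"
  proof (rule card_eq[where P = "\<lambda>h. h mod t = 0 \<or> h mod t = t - 1", OF assms])
    show "CP'' r t s \<subseteq> CP r t s" "RP'' r t s \<subseteq> RP r t s"
      by (simp_all add: CP''_def RP''_def)
  qed (simp_all add: toCP_CP''[OF _ assms refl] toRP_RP''[OF RP])
qed

end

theorem theorem4p1:
  fixes n r t :: nat and s :: "nat \<Rightarrow> nat"
  assumes "n > 0" and "r \<ge> 2" and "t \<ge> 2"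
    and "1 \<le> s 1" and "\<forall>i\<in>{1..<t - 1}. s i < s (i + 1)" and "s (t - 1) < r"
  shows "card (of_size (CP r t s) n) = card (of_size (RP r t s) n)
       \<and> card (of_size (CP' r t s) n) = card (of_size (RP' r t s) n)
       \<and> card (of_size (CP'' r t s) n) = card (of_size (RP'' r t s) n)"
proof -
  interpret residue_system r t s
    using assms by unfold_locales
  show ?thesis
    using card_CP_RP[OF assms(1)] by blast
qed

end
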